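(* Suppose $V$ is a countable set. Then the Pontryagin dual to $\mathscr{G}(V)$ is naturally identified with its subgroup $\mathscr{G}_0(V)$ of finite graphs, via Walsh functions. The Walsh functions also form an orthonormal basis of $L^2(\mathscr{G}(V), \mathbb{R})$. Moreover, a function $f : \mathscr{G}(V) \to \mathbb{C}$ is positive definite and satisfies $f(\mathbf{0}) = 1$, if and only if there exists a probability measure $\mu$ on $\mathscr{G}_0(V)$ (i.e., a countable set of nonnegative numbers $\mu(H)$, $H \in \mathscr{G}_0(V)$, that add up to $1$), such that \[ f(G) = \sum_{H \in \mathscr{G}_0(V)} (-1)^{|G \cap H|} \mu(H). \]
   Context: For a set $V$ of labelled vertices, $K_V$ denotes the complete graph on $V$. $\mathscr{G}(V)$ is the set of all graphs with vertex set $V$; each graph is identified with its edge set, a subset of $K_V$, so $\mathscr{G}(V) = (\mathbb{Z}/2\mathbb{Z})^{K_V}$ with the product topology, a compact Hausdorff abelian group under symmetric difference $\Delta$, with identity the empty graph $\mathbf{0}$. The space $L^2(\mathscr{G}(V),\mathbb{R})$ is taken with respect to the Haar probability measure on this group. $\mathscr{G}_0(V)$ is the set of graphs with finitely many edges. For $E \in \mathscr{G}_0(V)$, the corresponding Walsh function $\chi_E : \mathscr{G}(V) \to \mathbb{C}$ is $\chi_E(G) := (-1)^{|E \cap G|}$; the identification in the claim matches $E$ with $\chi_E$. A function $f : \mathscr{G}(V) \to \mathbb{C}$ is positive definite if for all integers $n \in \mathbb{N}$ and $G_1, \dots, G_n \in \mathscr{G}(V)$, the matrix $(f(G_i \Delta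 G_j))_{1 \le i,j \le n}$ is positive semidefinite. The Pontryagin dual of a locally compact abelian group is the set of its continuous unitary characters (continuous group homomorphisms into the unit circle in $\mathbb{C}^\times$), which form a group under pointwise multiplication.
   Formalization: In the "if and only if", "f is positive definite and f(0) = 1" is read as "f is continuous, positive definite and f(0) = 1"; without continuity the claim fails for infinite V (discontinuous homomorphisms into {1, -1}). *)

theory Defs
  imports "HOL-Probability.Probability" "HOL-Algebra.Group"
begin

definition complete_graph :: "'a set \<Rightarrow> 'a set set" where
  "complete_graph V = {{u, v} | u v. u \<in> V \<and> v \<in> V \<and> u \<noteq> v}"

text \<open>A graph with vertex set \<open>V\<close> is identified with its edge set.\<close>

definition graphs :: "'a set \<Rightarrow> 'a set set set" where
  "graphs V = Pow (complete_graph V)"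

definition finite_graphs :: "'a set \<Rightarrow> 'a set set set" where
  "finite_graphs V = {E \<in> graphs V. finite E}"

definition graph_group :: "'a set \<Rightarrow> 'a set set monoid" where
  "graph_group V = \<lparr>carrier = graphs V, mult = (\<lambda>G H. sym_diff G H), one = {}\<rparr>"

text \<open>The product topology on the maps from the edges of the complete graph to the discrete
  two-point space, transported along the bijection sending a graph to its indicator function.\<close>

definition graph_topology :: "'a set \<Rightarrow> 'a set set topology" where
  "graph_topology V =
     pullback_topology (graphs V) (\<lambda>G. \<lambda>e\<in>complete_graph V. e \<in> G)
       (product_topology (\<lambda>_. discrete_topology (UNIV :: bool set)) (complete_graph V))"

definition circle_group :: "complex monoid" where
  "circle_group = \<lparr>carrier = sphere 0 1, mult = (*), one = 1\<rparr>"

text \<open>Characters are extensional (\<open>undefined\<close> off the carrier), so that equality of elements of the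
  dual is equality of functions on the group.\<close>

definition pontryagin_dual :: "('g, 'm) monoid_scheme \<Rightarrow> 'g topology \<Rightarrow> ('g \<Rightarrow> complex) monoid" where
  "pontryagin_dual G T =
     \<lparr>carrier = {\<phi> \<in> hom G circle_group \<inter> extensional (carrier G).
                   continuous_map T (top_of_set (sphere 0 1)) \<phi>},
      mult = (\<lambda>\<phi> \<psi>. \<lambda>x\<in>carrier G. \<phi> x * \<psi> x),
      one = (\<lambda>x\<in>carrier G. 1)\<rparr>"

text \<open>Meaningful for \<open>E\<close> in \<open>finite_graphs V\<close> only: \<open>card\<close> is 0 on infinite sets.\<close>

definition walsh :: "'a set \<Rightarrow> 'a set set \<Rightarrow> 'a set set \<Rightarrow> complex" where
  "walsh V E = (\<lambda>G\<in>graphs V. (- 1) ^ card (E \<inter> G))"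

text \<open>Regularity is not part of the definition: for countable \<open>V\<close> the topology is compact and
  metrizable, so every Borel probability measure is regular.\<close>

definition is_haar_prob :: "'a set \<Rightarrow> 'a set set measure \<Rightarrow> bool" where
  "is_haar_prob V M \<longleftrightarrow>
     space M = graphs V \<and>
     sets M = sigma_sets (graphs V) {U. openin (graph_topology V) U} \<and>
     prob_space M \<and>
     (\<forall>G\<in>graphs V. \<forall>A\<in>sets M. emeasure M ((\<lambda>H. sym_diff G H) ` A) = emeasure M A)"

definition haar_prob :: "'a set \<Rightarrow> 'a set set measure" where
  "haar_prob V = (THE M. is_haar_prob V M)"

text \<open>\<open>L2 M\<close> consists of representatives; inner product, norm and density below depend only on
  classes modulo equality almost everywhere.\<close>

definition L2 :: "'x measure \<Rightarrow> ('x \<Rightarrow> real) set" where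
  "L2 M = {f \<in> borel_measurable M. integrable M (\<lambda>x. (f x)\<^sup>2)}"

definition L2_inner :: "'x measure \<Rightarrow> ('x \<Rightarrow> real) \<Rightarrow> ('x \<Rightarrow> real) \<Rightarrow> real" where
  "L2_inner M f g = (\<integral>x. f x * g x \<partial>M)"

definition L2_norm :: "'x measure \<Rightarrow> ('x \<Rightarrow> real) \<Rightarrow> real" where
  "L2_norm M f = sqrt (L2_inner M f f)"

text \<open>An orthonormal family with dense linear span.\<close>

definition L2_orthonormal_basis :: "'x measure \<Rightarrow> 'i set \<Rightarrow> ('i \<Rightarrow> 'x \<Rightarrow> real) \<Rightarrow> bool" where
  "L2_orthonormal_basis M I e \<longleftrightarrow>
     (\<forall>i\<in>I. e i \<in> L2 M) \<and>
     (\<forall>i\<in>I. \<forall>j\<in>I. L2_inner M (e i) (e j) = (if i = j then 1 else 0)) \<and>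
     (\<forall>f\<in>L2 M. \<forall>\<epsilon>>0. \<exists>F c. finite F \<and> F \<subseteq> I \<and>
        L2_norm M (\<lambda>x. f x - (\<Sum>i\<in>F. c i * e i x)) < \<epsilon>)"

definition positive_semidefinite :: "nat \<Rightarrow> (nat \<Rightarrow> nat \<Rightarrow> complex) \<Rightarrow> bool" where
  "positive_semidefinite n A \<longleftrightarrow>
     (\<forall>i<n. \<forall>j<n. A j i = cnj (A i j)) \<and>
     (\<forall>z :: nat \<Rightarrow> complex. 0 \<le> Re (\<Sum>i<n. \<Sum>j<n. cnj (z i) * A i j * z j))"

text \<open>Continuity is not included. It has to be required separately in Bochner's theorem: for infinite
  \<open>V\<close> there are discontinuous homomorphisms into the signs, which are positive definite but are
  not transforms of a measure on the dual.\<close>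

definition positive_definite :: "'a set \<Rightarrow> ('a set set \<Rightarrow> complex) \<Rightarrow> bool" where
  "positive_definite V f \<longleftrightarrow>
     (\<forall>n. \<forall>G :: nat \<Rightarrow> 'a set set. (\<forall>i<n. G i \<in> graphs V) \<longrightarrow>
        positive_semidefinite n (\<lambda>i j. f (sym_diff (G i) (G j))))"

end

theory Submission
  imports Defs
begin

text \<open>Every continuous character has values in the signs; by continuity it is trivial on the graphs
  that avoid some finite set of edges, so it is the Walsh function of the finite set of edges on
  which it equals \<open>-1\<close>.

  Haar measure is the law of independent fair coins on the edges. Translation invariance forces a
  cylinder on \<open>n\<close> edges to have measure \<open>2\<^sup>-\<^sup>n\<close>, and it makes the nontrivial Walsh functions have
  integral \<open>0\<close>. Indicators of cylinders are Walsh polynomials, and a Dynkin argument followed by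
  approximation with simple functions extends density to the whole space.

  For the converse half of Bochner's theorem no integration is needed. For a finite edge set \<open>F\<close>
  the Fourier coefficients of \<open>f\<close> restricted to the subgraphs of \<open>F\<close> are nonnegative and sum to
  \<open>f {} = 1\<close>. The weights for \<open>F\<close> are the marginals of those for any larger \<open>F'\<close>, so the
  coefficient at a fixed \<open>H\<close> decreases in \<open>F\<close> and converges to some \<open>\<mu> H\<close>. Continuity at the empty
  graph is tightness: the mass on the subgraphs of \<open>F\<^sub>0\<close> is the average of \<open>f\<close> over the subgraphs of
  \<open>F - F\<^sub>0\<close>, hence close to \<open>1\<close>.\<close>

section \<open>Walsh functions as characters\<close>

text \<open>Passing from \<open>card A + card B\<close> to the cardinality of the symmetric
  difference drops the common part twice, which leaves the parity unchanged.\<close>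

lemma minus_one_power_card_sym_diff:
  assumes "finite A" "finite B"
  shows "(-1) ^ card (sym_diff A B) = ((-1) ^ card A * (-1) ^ card B :: 'r::comm_ring_1)"
proof -
  have A: "card A = card (A - B) + card (A \<inter> B)" and B: "card B = card (B - A) + card (A \<inter> B)"
    using assms by (simp_all add: card_Diff_subset_Int Int_commute card_mono)
  have D: "card (sym_diff A B) = card (A - B) + card (B - A)"
    using assms by (intro card_Un_disjoint) auto
  show ?thesis
    unfolding A B D by (simp add: power_add algebra_simps flip: power_mult_distrib)
qed

text \<open>A real counterpart of \<open>walsh\<close>, not restricted to graphs and symmetric in
  its two arguments, so that characters and group elements can exchange roles in the Fourier
  computations.\<close>

definition chi :: "'e set \<Rightarrow> 'e set \<Rightarrow> real" where
  "chi E G = (-1) ^ card (E \<inter> G)"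

lemma chi_commute: "chi E G = chi G E"
  by (simp add: chi_def Int_commute)

lemma chi_empty [simp]: "chi E {} = 1" "chi {} G = 1"
  by (simp_all add: chi_def)

lemma chi_singleton: "chi E {e} = (if e \<in> E then -1 else 1)"
  by (simp add: chi_def)

lemma abs_chi [simp]: "\<bar>chi E G\<bar> = 1"
  by (simp add: chi_def power_abs)

lemma chi_sym_diff:
  assumes "finite E"
  shows "chi E (sym_diff G H) = chi E G * chi E H"
proof -
  have "E \<inter> sym_diff G H = sym_diff (E \<inter> G) (E \<inter> H)" by blast
  with assms show ?thesis
    by (simp only: chi_def) (simp add: minus_one_power_card_sym_diff)
qed

lemma chi_sym_diff_left:
  assumes "finite E" "finite F"
  shows "chi (sym_diff E F) G = chi E G * chi F G"
proof -
  have "sym_diff E F \<inter> G = sym_diff (E \<inter> G) (F \<inter> G)" by blast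
  with assms show ?thesis
    by (simp only: chi_def) (simp add: minus_one_power_card_sym_diff)
qed

text \<open>Orthogonality of characters on the finite group of subsets of \<open>F\<close>:
  splitting off an edge \<open>e\<close> multiplies the sum by \<open>1 + chi {e} G\<close>, which
  is 2 or 0.\<close>

lemma sum_Pow_chi:
  assumes "finite F"
  shows "(\<Sum>H\<in>Pow F. chi H G) = (if F \<inter> G = {} then 2 ^ card F else 0)"
  using assms
proof (induction F)
  case empty
  then show ?case by simp
next
  case (insert e F)
  have "(\<Sum>H\<in>Pow (insert e F). chi H G)
      = (\<Sum>H\<in>Pow F. chi H G) + (\<Sum>H\<in>Pow F. chi (insert e H) G)"
    using insert.hyps unfolding Pow_insert
    by (subst sum.union_disjoint)
       (auto intro!: arg_cong2[where f="(+)"] sum.reindex_cong[of "insert e"] inj_onI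
          simp: insert_ident subset_iff Pow_iff)
  also have "(\<Sum>H\<in>Pow F. chi (insert e H) G) = chi {e} G * (\<Sum>H\<in>Pow F. chi H G)"
    unfolding sum_distrib_left
  proof (rule sum.cong[OF refl])
    fix H assume "H \<in> Pow F"
    then have "sym_diff {e} H = insert e H" "finite H"
      using insert.hyps by (auto intro: finite_subset)
    then show "chi (insert e H) G = chi {e} G * chi H G"
      using chi_sym_diff_left[of "{e}" H G] by simp
  qed
  finally show ?case
    using insert by (auto simp: chi_def)
qed

text \<open>A basic open box of the product constrains only finitely many coordinates, so a
  neighbourhood of \<open>G\<close> is given by agreement with \<open>G\<close> on a finite edge
  set. Later arguments work with such edge sets instead of the pullback.\<close>

lemma openin_graph_topology:
  "openin (graph_topology V) U \<longleftrightarrow> U \<subseteq> graphs V \<and>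
     (\<forall>G\<in>U. \<exists>F. finite F \<and> F \<subseteq> complete_graph V \<and>
        (\<forall>G'\<in>graphs V. G' \<inter> F = G \<inter> F \<longrightarrow> G' \<in> U))"
  (is "?L \<longleftrightarrow> ?R")
proof
  let ?K = "complete_graph V"
  let ?r = "\<lambda>G. \<lambda>e\<in>?K. e \<in> G"
  let ?T = "product_topology (\<lambda>_. discrete_topology (UNIV :: bool set)) ?K"
  {
    assume ?L
    then obtain W where W: "openin ?T W" "U = ?r -` W \<inter> graphs V"
      by (auto simp: graph_topology_def openin_pullback_topology)
    have "\<exists>F. finite F \<and> F \<subseteq> ?K \<and> (\<forall>G'\<in>graphs V. G' \<inter> F = G \<inter> F \<longrightarrow> G' \<in> U)"
      if G: "G \<in> U" for G
    proof -
      have "?r G \<in> W" using G W by auto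
      \<comment> \<open>The coordinates at which the box \<open>X\<close> imposes a condition form
        the required finite edge set.\<close>
      with W(1) obtain X where X: "finite {i\<in>?K. X i \<noteq> UNIV}" "?r G \<in> Pi\<^sub>E ?K X" "Pi\<^sub>E ?K X \<subseteq> W"
        unfolding openin_product_topology_alt by auto
      have "G' \<in> U" if "G' \<in> graphs V" "G' \<inter> {i\<in>?K. X i \<noteq> UNIV} = G \<inter> {i\<in>?K. X i \<noteq> UNIV}" for G'
      proof -
        have "(e \<in> G') \<in> X e" if "e \<in> ?K" for e
        proof (cases "X e = UNIV")
          case False
          then have "e \<in> G' \<longleftrightarrow> e \<in> G" using \<open>G' \<inter> _ = _\<close> that by auto
          then show ?thesis using X(2) that by (auto simp: PiE_iff)
        qed simp
        then have "?r G' \<in> Pi\<^sub>E ?K X" by auto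
        then have "?r G' \<in> W" using X(3) by (rule rev_subsetD)
        with W(2) that show ?thesis by auto
      qed
      then show ?thesis using X(1) by (intro exI[of _ "{i\<in>?K. X i \<noteq> UNIV}"]) simp
    qed
    moreover have "U \<subseteq> graphs V" using W(2) by simp
    ultimately show ?R by simp
  }
  {
    assume R: ?R
    then obtain F where F: "\<And>G. G \<in> U \<Longrightarrow> finite (F G) \<and> F G \<subseteq> ?K \<and>
        (\<forall>G'\<in>graphs V. G' \<inter> F G = G \<inter> F G \<longrightarrow> G' \<in> U)" by metis
    \<comment> \<open>A union of boxes, each forcing agreement with \<open>G\<close> on
      \<open>F G\<close>. Here \<open>{e \<in> G}\<close> is a one-element set of truth values, not
      a comprehension.\<close>
    define W where "W = (\<Union>G\<in>U. Pi\<^sub>E ?K (\<lambda>e. if e \<in> F G then {e \<in> G} else UNIV))"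
    have "openin ?T W"
      unfolding W_def
    proof (intro openin_Union ballI, clarsimp)
      fix G assume "G \<in> U"
      then have "finite (F G)" using F by blast
      then show "openin ?T (Pi\<^sub>E ?K (\<lambda>e. if e \<in> F G then {e \<in> G} else UNIV))"
        by (subst openin_PiE_gen) (auto intro: finite_subset[of _ "F G"])
    qed
    moreover have "U = ?r -` W \<inter> graphs V"
    proof
      show "U \<subseteq> ?r -` W \<inter> graphs V"
      proof
        fix G assume "G \<in> U"
        moreover have "?r G \<in> Pi\<^sub>E ?K (\<lambda>e. if e \<in> F G then {e \<in> G} else UNIV)" by auto
        ultimately show "G \<in> ?r -` W \<inter> graphs V" using R unfolding W_def by (intro IntI vimageI2 UN_I) auto
      qed
      show "?r -` W \<inter> graphs V \<subseteq> U"
      proof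
        fix G' assume "G' \<in> ?r -` W \<inter> graphs V"
        then obtain G where G: "G \<in> U" "G' \<in> graphs V"
          and *: "\<And>e. e \<in> ?K \<Longrightarrow> (e \<in> G') \<in> (if e \<in> F G then {e \<in> G} else UNIV)"
          unfolding W_def by (auto simp: PiE_iff split del: if_split)
        have "e \<in> G' \<longleftrightarrow> e \<in> G" if "e \<in> F G" for e
          using *[of e] F[OF G(1)] that by auto
        then have "G' \<inter> F G = G \<inter> F G" by blast
        with F[OF G(1)] G(2) show "G' \<in> U" by simp
      qed
    qed
    ultimately show ?L
      unfolding graph_topology_def openin_pullback_topology by (intro exI conjI)
  }
qed

lemma topspace_graph_topology [simp]: "topspace (graph_topology V) = graphs V"
proof
  show "topspace (graph_topology V) \<subseteq> graphs V"
    unfolding topspace_def by (auto simp: openin_graph_topology)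
  show "graphs V \<subseteq> topspace (graph_topology V)"
    by (intro openin_subset) (auto simp: openin_graph_topology)
qed

text \<open>In a metric target, balls around \<open>f G\<close> suffice as test sets, so continuity
  takes an \<epsilon>-form with a finite edge set in place of a radius.\<close>

lemma continuous_map_graph_topology:
  fixes f :: "'a set set \<Rightarrow> 'b::metric_space"
  shows "continuous_map (graph_topology V) euclidean f \<longleftrightarrow>
    (\<forall>G\<in>graphs V. \<forall>\<epsilon>>0. \<exists>F. finite F \<and> F \<subseteq> complete_graph V \<and>
        (\<forall>G'\<in>graphs V. G' \<inter> F = G \<inter> F \<longrightarrow> dist (f G') (f G) < \<epsilon>))"
  (is "?L \<longleftrightarrow> ?R")
proof
  assume L: ?L
  show ?R
  proof (intro ballI allI impI)
    fix G and \<epsilon> :: real assume G: "G \<in> graphs V" and "\<epsilon> > 0"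
    have "openin (graph_topology V) {G' \<in> graphs V. f G' \<in> ball (f G) \<epsilon>}"
      using openin_continuous_map_preimage[OF L, of "ball (f G) \<epsilon>"] by simp
    then show "\<exists>F. finite F \<and> F \<subseteq> complete_graph V \<and>
        (\<forall>G'\<in>graphs V. G' \<inter> F = G \<inter> F \<longrightarrow> dist (f G') (f G) < \<epsilon>)"
      unfolding openin_graph_topology using G \<open>\<epsilon> > 0\<close>
      by (simp add: dist_commute)
  qed
next
  assume R: ?R
  show ?L
    unfolding continuous_map
  proof (intro conjI allI impI)
    fix W :: "'b set" assume "openin euclidean W"
    then have "open W" by simp
    show "openin (graph_topology V) {G \<in> topspace (graph_topology V). f G \<in> W}"
      unfolding openin_graph_topology
    proof (intro conjI ballI)
      fix G assume G: "G \<in> {G \<in> topspace (graph_topology V). f G \<in> W}"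
      with \<open>open W\<close> obtain \<epsilon> where "\<epsilon> > 0" and \<epsilon>: "\<And>y. dist y (f G) < \<epsilon> \<Longrightarrow> y \<in> W"
        unfolding open_dist by auto
      from R G \<open>\<epsilon> > 0\<close> obtain F where "finite F" "F \<subseteq> complete_graph V"
        "\<forall>G'\<in>graphs V. G' \<inter> F = G \<inter> F \<longrightarrow> dist (f G') (f G) < \<epsilon>"
        by (metis (lifting) mem_Collect_eq topspace_graph_topology)
      with \<epsilon> show "\<exists>F. finite F \<and> F \<subseteq> complete_graph V \<and> (\<forall>G'\<in>graphs V. G' \<inter> F = G \<inter> F \<longrightarrow>
          G' \<in> {G \<in> topspace (graph_topology V). f G \<in> W})" by (intro exI[of _ F]) simp
    qed auto
  qed auto
qed

lemma sym_diff_graphs: "G \<in> graphs V \<Longrightarrow> H \<in> graphs V \<Longrightarrow> sym_diff G H \<in> graphs V"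
  by (auto simp: graphs_def)

lemma subset_graphs: "G \<in> graphs V \<Longrightarrow> H \<subseteq> G \<Longrightarrow> H \<in> graphs V"
  by (auto simp: graphs_def)

lemma empty_graphs [simp]: "{} \<in> graphs V"
  by (auto simp: graphs_def)

lemma walsh_eq_chi: "G \<in> graphs V \<Longrightarrow> walsh V E G = of_real (chi E G)"
  by (simp add: walsh_def chi_def)

section \<open>The group of graphs and its Pontryagin dual\<close>

lemma group_graph_group: "group (graph_group V)"
proof (rule groupI)
  fix G assume "G \<in> carrier (graph_group V)"
  then show "\<exists>H\<in>carrier (graph_group V). H \<otimes>\<^bsub>graph_group V\<^esub> G = \<one>\<^bsub>graph_group V\<^esub>"
    by (intro bexI[of _ G]) (auto simp: graph_group_def)
qed (auto simp: graph_group_def graphs_def)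

lemma subgroup_finite_graphs: "subgroup (finite_graphs V) (graph_group V)"
proof -
  interpret group "graph_group V" by (rule group_graph_group)
  show ?thesis
  proof (rule subgroupI)
    fix G assume G: "G \<in> finite_graphs V"
    have "inv\<^bsub>graph_group V\<^esub> G = G"
      by (rule inv_equality) (use G in \<open>auto simp: graph_group_def finite_graphs_def\<close>)
    with G show "inv\<^bsub>graph_group V\<^esub> G \<in> finite_graphs V" by simp
  next
    show "finite_graphs V \<noteq> {}" by (auto simp: finite_graphs_def graphs_def)
  qed (auto simp: finite_graphs_def graph_group_def graphs_def)
qed

lemma finite_graphs_iff: "E \<in> finite_graphs V \<longleftrightarrow> E \<subseteq> complete_graph V \<and> finite E"
  by (auto simp: finite_graphs_def graphs_def)

text \<open>Continuity into the circle as a subspace amounts to continuity into the plane together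
  with values of norm 1.\<close>

lemma mem_pontryagin_dual_graph_group:
  "\<phi> \<in> carrier (pontryagin_dual (graph_group V) (graph_topology V)) \<longleftrightarrow>
     \<phi> \<in> extensional (graphs V) \<and> continuous_map (graph_topology V) euclidean \<phi> \<and>
     (\<forall>G\<in>graphs V. norm (\<phi> G) = 1) \<and>
     (\<forall>G\<in>graphs V. \<forall>H\<in>graphs V. \<phi> (sym_diff G H) = \<phi> G * \<phi> H)"
  by (auto simp: pontryagin_dual_def hom_def circle_group_def graph_group_def
        continuous_map_in_subtopology Pi_iff)

text \<open>The value at \<open>G\<close> depends only on the edges of \<open>G\<close> in
  \<open>E\<close>, so \<open>E\<close> itself is a suitable finite edge set for every graph and
  every \<epsilon>.\<close>

lemma walsh_in_dual:
  assumes "E \<in> finite_graphs V"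
  shows "walsh V E \<in> carrier (pontryagin_dual (graph_group V) (graph_topology V))"
proof -
  have E: "E \<subseteq> complete_graph V" "finite E" using assms by (auto simp: finite_graphs_iff)
  have "continuous_map (graph_topology V) euclidean (walsh V E)"
    unfolding continuous_map_graph_topology
  proof (intro ballI allI impI)
    fix G and \<epsilon> :: real assume "G \<in> graphs V" "\<epsilon> > 0"
    with E show "\<exists>F. finite F \<and> F \<subseteq> complete_graph V \<and>
        (\<forall>G'\<in>graphs V. G' \<inter> F = G \<inter> F \<longrightarrow> dist (walsh V E G') (walsh V E G) < \<epsilon>)"
      by (intro exI[of _ E]) (auto simp: walsh_def Int_commute)
  qed
  moreover have "walsh V E (sym_diff G H) = walsh V E G * walsh V E H"
    if "G \<in> graphs V" "H \<in> graphs V" for G H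
    using that by (simp add: walsh_eq_chi sym_diff_graphs chi_sym_diff[OF E(2)])
  ultimately show ?thesis
    unfolding mem_pontryagin_dual_graph_group by (simp add: walsh_eq_chi) (simp add: walsh_def)
qed

lemma dual_is_walsh:
  assumes "\<phi> \<in> carrier (pontryagin_dual (graph_group V) (graph_topology V))"
  obtains E where "E \<in> finite_graphs V" "\<phi> = walsh V E"
proof -
  have ext: "\<phi> \<in> extensional (graphs V)"
    and cont: "continuous_map (graph_topology V) euclidean \<phi>"
    and mult: "\<And>G H. G \<in> graphs V \<Longrightarrow> H \<in> graphs V \<Longrightarrow> \<phi> (sym_diff G H) = \<phi> G * \<phi> H"
    and nz: "\<And>G. G \<in> graphs V \<Longrightarrow> norm (\<phi> G) = 1"
    using assms by (simp_all add: mem_pontryagin_dual_graph_group)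
  have one: "\<phi> {} = 1"
    using mult[of "{}" "{}"] nz[of "{}"] by auto
  \<comment> \<open>Every graph is its own inverse, so its value squares to
    \<open>\<phi> {} = 1\<close>.\<close>
  have pm: "\<phi> G = 1 \<or> \<phi> G = -1" if "G \<in> graphs V" for G
    using mult[OF that that] one by (auto simp: square_eq_1_iff)
  \<comment> \<open>The two signs are at distance 2, so closeness within 1 to
    \<open>\<phi> {}\<close> forces the value 1.\<close>
  obtain F where F: "finite F" "F \<subseteq> complete_graph V"
    "\<And>G'. G' \<in> graphs V \<Longrightarrow> G' \<inter> F = {} \<Longrightarrow> dist (\<phi> G') (\<phi> {}) < 1"
    using cont[unfolded continuous_map_graph_topology, rule_format, of "{}" 1] by auto
  have F1: "\<phi> G = 1" if "G \<in> graphs V" "G \<inter> F = {}" for G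
    using F(3)[OF that] pm[OF that(1)] one by (auto simp: dist_norm)
  define E where "E = {e \<in> F. \<phi> {e} = -1}"
  \<comment> \<open>A finite graph is the product in the group of its one-edge graphs, which
    determine both sides.\<close>
  have fin: "\<phi> G = of_real (chi E G)" if "finite G" "G \<subseteq> F" for G
    using that
  proof (induction G)
    case (insert e G)
    have g: "{e} \<in> graphs V" "G \<in> graphs V" using insert F by (auto simp: graphs_def)
    have eq: "sym_diff {e} G = insert e G" using insert by auto
    have "\<phi> (insert e G) = \<phi> {e} * \<phi> G"
      using mult[OF g] by (simp only: eq)
    also have "\<phi> {e} = of_real (chi E {e})"
      using pm[OF g(1)] insert by (auto simp: E_def chi_def)
    also have "\<phi> G = of_real (chi E G)" using insert by auto
    finally show ?case
      using chi_sym_diff[of E "{e}" G] F(1) by (simp only: eq) (simp add: E_def)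
  qed (simp add: one)
  have "\<phi> G = of_real (chi E G)" if "G \<in> graphs V" for G
  proof -
    \<comment> \<open>\<open>G\<close> is the product of its finite part inside \<open>F\<close>,
      covered by \<open>fin\<close>, and of a part avoiding \<open>F\<close>, on which the character
      is trivial.\<close>
    have eq: "sym_diff (G \<inter> F) (G - F) = G" by auto
    have "\<phi> G = \<phi> (G \<inter> F) * \<phi> (G - F)"
      using mult[of "G \<inter> F" "G - F"] that by (simp only: eq) (auto intro: subset_graphs)
    also have "\<phi> (G - F) = 1" using that by (intro F1) (auto intro: subset_graphs)
    also have "\<phi> (G \<inter> F) = of_real (chi E (G \<inter> F))" using F by (intro fin) auto
    also have "chi E (G \<inter> F) = chi E G"
      unfolding chi_def by (rule arg_cong[where f="\<lambda>A. (-1) ^ card A"]) (auto simp: E_def)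
    finally show ?thesis by simp
  qed
  then have "\<phi> = walsh V E"
    using ext by (intro extensionalityI[of _ "graphs V"]) (auto simp: walsh_def chi_def)
  moreover have "E \<in> finite_graphs V" using F by (auto simp: finite_graphs_iff E_def)
  ultimately show ?thesis using that by blast
qed

text \<open>One-edge graphs separate the Walsh functions, since the sign at \<open>{e}\<close> tells
  whether \<open>e\<close> lies in the edge set. Surjectivity is
  \<open>dual_is_walsh\<close>.\<close>

lemma walsh_iso:
  "walsh V \<in> iso (graph_group V\<lparr>carrier := finite_graphs V\<rparr>)
     (pontryagin_dual (graph_group V) (graph_topology V))"
proof -
  have "inj_on (walsh V) (finite_graphs V)"
  proof (rule inj_onI)
    fix E F assume E: "E \<in> finite_graphs V" "F \<in> finite_graphs V" and eq: "walsh V E = walsh V F"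
    have "e \<in> E \<longleftrightarrow> e \<in> F" if "e \<in> complete_graph V" for e
    proof -
      have "{e} \<in> graphs V" using that by (auto simp: graphs_def)
      then have "chi E {e} = chi F {e}"
        using fun_cong[OF eq, of "{e}"] by (simp add: walsh_eq_chi)
      then show ?thesis by (auto simp: chi_singleton split: if_splits)
    qed
    with E show "E = F" by (auto simp: finite_graphs_iff)
  qed
  moreover have "walsh V ` finite_graphs V
      = carrier (pontryagin_dual (graph_group V) (graph_topology V))"
    using walsh_in_dual by (auto elim!: dual_is_walsh)
  moreover have "walsh V (sym_diff E F) = (\<lambda>G\<in>graphs V. walsh V E G * walsh V F G)"
    if "E \<in> finite_graphs V" "F \<in> finite_graphs V" for E F
  proof (rule extensionalityI[of _ "graphs V"])
    fix G assume "G \<in> graphs V"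
    with that show "walsh V (sym_diff E F) G = (\<lambda>G\<in>graphs V. walsh V E G * walsh V F G) G"
      by (simp add: walsh_eq_chi chi_sym_diff_left finite_graphs_iff)
  qed (auto simp: walsh_def)
  then have "walsh V \<in> hom (graph_group V\<lparr>carrier := finite_graphs V\<rparr>)
      (pontryagin_dual (graph_group V) (graph_topology V))"
    by (intro homI walsh_in_dual) (simp_all add: graph_group_def pontryagin_dual_def)
  ultimately show ?thesis
    by (simp add: iso_def bij_betw_def)
qed

section \<open>Haar measure\<close>

definition cylinder :: "'a set \<Rightarrow> 'a set set \<Rightarrow> 'a set set \<Rightarrow> 'a set set set" where
  "cylinder V F S = {G \<in> graphs V. G \<inter> F = S}"

text \<open>The empty set is added to make the family closed under intersections: cylinders with
  conflicting traces are disjoint.\<close>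

definition cylinders :: "'a set \<Rightarrow> 'a set set set set" where
  "cylinders V = insert {} {cylinder V F S | F S. finite F \<and> F \<subseteq> complete_graph V \<and> S \<subseteq> F}"

lemma cylinders_E:
  assumes "A \<in> cylinders V"
  obtains "A = {}"
  | F S where "A = cylinder V F S" "finite F" "F \<subseteq> complete_graph V" "S \<subseteq> F"
  using assms unfolding cylinders_def by blast

lemma cylinders_I:
  "finite F \<Longrightarrow> F \<subseteq> complete_graph V \<Longrightarrow> S \<subseteq> F \<Longrightarrow> cylinder V F S \<in> cylinders V"
  unfolding cylinders_def by blast

lemma cylinders_Pow: "cylinders V \<subseteq> Pow (graphs V)"
  by (auto simp: cylinders_def cylinder_def)

lemma graphs_cylinder: "graphs V = cylinder V {} {}"
  by (auto simp: cylinder_def)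

lemma graphs_in_cylinders: "graphs V \<in> cylinders V"
  unfolding graphs_cylinder by (rule cylinders_I) auto

text \<open>Since each trace lies in its own edge set, the two are compatible exactly when they
  agree on the overlap of \<open>F\<close> and \<open>F'\<close>.\<close>

lemma cylinder_Int:
  assumes "S \<subseteq> F" "S' \<subseteq> F'"
  shows "cylinder V F S \<inter> cylinder V F' S'
    = (if S \<inter> F' = S' \<inter> F then cylinder V (F \<union> F') (S \<union> S') else {})"
proof -
  have "G \<inter> F = S \<and> G \<inter> F' = S' \<longleftrightarrow> S \<inter> F' = S' \<inter> F \<and> G \<inter> (F \<union> F') = S \<union> S'" for G
    using assms by blast
  then have "{G \<in> graphs V. G \<inter> F = S \<and> G \<inter> F' = S'}
      = {G \<in> graphs V. S \<inter> F' = S' \<inter> F \<and> G \<inter> (F \<union> F') = S \<union> S'}"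
    by presburger
  then show ?thesis
    by (simp add: cylinder_def conj_ac flip: Collect_conj_eq)
qed

lemma Int_stable_cylinders: "Int_stable (cylinders V)"
proof (rule Int_stableI)
  fix A B assume A: "A \<in> cylinders V" and B: "B \<in> cylinders V"
  from A show "A \<inter> B \<in> cylinders V"
  proof (cases rule: cylinders_E)
    case 1
    then show ?thesis by (simp add: cylinders_def)
  next
    case A: (2 F S)
    from B show ?thesis
    proof (cases rule: cylinders_E)
      case 1
      then show ?thesis by (simp add: cylinders_def)
    next
      case B: (2 F' S')
      have "cylinder V (F \<union> F') (S \<union> S') \<in> cylinders V"
        using A B by (intro cylinders_I) auto
      moreover have "{} \<in> cylinders V" by (simp add: cylinders_def)
      ultimately show ?thesis using A B by (simp add: cylinder_Int)
    qed
  qed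
qed

section \<open>The Borel sigma-algebra is generated by the cylinders\<close>

lemma countable_complete_graph:
  assumes "countable V"
  shows "countable (complete_graph V)"
proof (rule countable_subset)
  show "complete_graph V \<subseteq> (\<lambda>(u, v). {u, v}) ` (V \<times> V)"
    by (auto simp: complete_graph_def)
qed (use assms in auto)

lemma countable_cylinders:
  assumes "countable V"
  shows "countable (cylinders V)"
proof (rule countable_subset)
  let ?I = "SIGMA F:{F. finite F \<and> F \<subseteq> complete_graph V}. Pow F"
  show "cylinders V \<subseteq> insert {} ((\<lambda>(F, S). cylinder V F S) ` ?I)"
    unfolding cylinders_def by blast
  have "countable ?I"
    using countable_complete_graph[OF assms]
    by (intro countable_SIGMA countable_Collect_finite_subset) (auto intro: countable_finite)
  then show "countable (insert {} ((\<lambda>(F, S). cylinder V F S) ` ?I))" by simp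
qed

text \<open>An open set is the union of the cylinders it contains. Countability of \<open>V\<close>
  makes this a countable union; conversely, cylinders are open.\<close>

lemma sigma_sets_openin_graph_topology:
  assumes "countable V"
  shows "sigma_sets (graphs V) {U. openin (graph_topology V) U} = sigma_sets (graphs V) (cylinders V)"
proof (rule sigma_sets_eqI)
  fix U assume "U \<in> {U. openin (graph_topology V) U}"
  then have sub: "U \<subseteq> graphs V"
    and nbhd: "\<And>G. G \<in> U \<Longrightarrow> \<exists>F. finite F \<and> F \<subseteq> complete_graph V \<and>
        (\<forall>G'\<in>graphs V. G' \<inter> F = G \<inter> F \<longrightarrow> G' \<in> U)"
    unfolding openin_graph_topology by simp_all
  have "U = \<Union>{A \<in> cylinders V. A \<subseteq> U}"
  proof
    show "U \<subseteq> \<Union>{A \<in> cylinders V. A \<subseteq> U}"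
    proof
      fix G assume G: "G \<in> U"
      then obtain F where F: "finite F" "F \<subseteq> complete_graph V"
        "\<forall>G'\<in>graphs V. G' \<inter> F = G \<inter> F \<longrightarrow> G' \<in> U" using nbhd by metis
      from F(3) have "cylinder V F (G \<inter> F) \<subseteq> U"
        unfolding cylinder_def by blast
      moreover have "cylinder V F (G \<inter> F) \<in> cylinders V"
        using F(1,2) by (rule cylinders_I) simp
      moreover have "G \<in> cylinder V F (G \<inter> F)" using G sub unfolding cylinder_def by blast
      ultimately show "G \<in> \<Union>{A \<in> cylinders V. A \<subseteq> U}" by blast
    qed
  qed auto
  also have "\<dots> \<in> sigma_sets (graphs V) (cylinders V)"
  proof (rule sigma_sets_UNION)
    show "countable {A \<in> cylinders V. A \<subseteq> U}"
      using countable_cylinders[OF assms] by (rule countable_subset[rotated]) blast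
  qed simp
  finally show "U \<in> sigma_sets (graphs V) (cylinders V)" .
next
  fix A assume "A \<in> cylinders V"
  then have "openin (graph_topology V) A"
  proof (cases rule: cylinders_E)
    case (2 F S)
    have "\<exists>F. finite F \<and> F \<subseteq> complete_graph V \<and>
        (\<forall>G'\<in>graphs V. G' \<inter> F = G \<inter> F \<longrightarrow> G' \<in> A)" if "G \<in> A" for G
      using 2 that by (intro exI[of _ F]) (simp add: cylinder_def)
    moreover have "A \<subseteq> graphs V" using 2 by (auto simp: cylinder_def)
    ultimately show ?thesis unfolding openin_graph_topology by blast
  qed simp
  then show "A \<in> sigma_sets (graphs V) {U. openin (graph_topology V) U}" by simp
qed

text \<open>Restriction to \<open>F\<close> is a homomorphism for the symmetric difference, so
  translation permutes the cylinders over a fixed \<open>F\<close>.\<close>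

lemma vimage_sym_diff_cylinder:
  assumes "G \<in> graphs V" "S \<subseteq> F"
  shows "(\<lambda>H. sym_diff G H) -` cylinder V F S \<inter> graphs V = cylinder V F (sym_diff (G \<inter> F) S)"
proof -
  have "sym_diff G H \<inter> F = S \<longleftrightarrow> H \<inter> F = sym_diff (G \<inter> F) S" for H
    using assms(2) by blast
  then have "H \<in> (\<lambda>H. sym_diff G H) -` cylinder V F S \<inter> graphs V
      \<longleftrightarrow> H \<in> cylinder V F (sym_diff (G \<inter> F) S)" for H
    using sym_diff_graphs[OF assms(1), of H] unfolding cylinder_def vimage_def by simp metis
  then show ?thesis by blast
qed

text \<open>Translation is an involution. This links the images in \<open>is_haar_prob\<close> with
  the preimages in \<open>distr\<close>.\<close>

lemma image_sym_diff:
  assumes G: "G \<in> graphs V" and A: "A \<subseteq> graphs V"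
  shows "(\<lambda>H. sym_diff G H) ` A = (\<lambda>H. sym_diff G H) -` A \<inter> graphs V"
proof -
  have inv: "sym_diff G (sym_diff G H) = H" for H by blast
  show ?thesis
  proof (intro equalityI subsetI)
    fix H assume "H \<in> (\<lambda>H. sym_diff G H) ` A"
    then obtain H' where "H' \<in> A" "H = sym_diff G H'" by (rule imageE)
    moreover from this have "sym_diff G H = H'" by (simp only: inv)
    ultimately show "H \<in> (\<lambda>H. sym_diff G H) -` A \<inter> graphs V"
      using sym_diff_graphs[OF G, of H'] A by (simp only: vimage_def Int_iff mem_Collect_eq subset_iff)
  next
    fix H assume "H \<in> (\<lambda>H. sym_diff G H) -` A \<inter> graphs V"
    then show "H \<in> (\<lambda>H. sym_diff G H) ` A"
      by (intro image_eqI[of _ _ "sym_diff G H"]) (simp_all only: inv vimage_eq Int_iff)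
  qed
qed

section \<open>Translation invariance and the measure of cylinders\<close>

context
  fixes V :: "'a set" and M :: "'a set set measure"
  assumes countable_V: "countable V"
    and sets_M: "sets M = sigma_sets (graphs V) (cylinders V)"
begin

lemma space_eq_graphs: "space M = graphs V"
proof -
  have "sets M = sets (sigma (graphs V) (cylinders V))"
    unfolding sets_M sets_measure_of[OF cylinders_Pow] ..
  then have "space M = space (sigma (graphs V) (cylinders V))" by (rule sets_eq_imp_space_eq)
  then show ?thesis by (simp add: space_measure_of_conv)
qed

lemma measurable_sym_diff:
  assumes G: "G \<in> graphs V"
  shows "(\<lambda>H. sym_diff G H) \<in> measurable M M"
proof (rule measurable_sigma_sets[OF sets_M cylinders_Pow])
  show "(\<lambda>H. sym_diff G H) \<in> space M \<rightarrow> graphs V"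
    using G by (auto simp: space_eq_graphs graphs_def)
  fix A assume "A \<in> cylinders V"
  then show "(\<lambda>H. sym_diff G H) -` A \<inter> space M \<in> sets M"
  proof (cases rule: cylinders_E)
    case (2 F S)
    have "(\<lambda>H. sym_diff G H) -` A \<inter> space M = cylinder V F (sym_diff (G \<inter> F) S)"
      unfolding space_eq_graphs 2(1) by (rule vimage_sym_diff_cylinder[OF G \<open>S \<subseteq> F\<close>])
    also have "\<dots> \<in> sets M"
      unfolding sets_M using 2 by (intro sigma_sets.Basic cylinders_I) auto
    finally show ?thesis .
  qed simp
qed

text \<open>Invariance as an equality of measures: in this form it can be checked on the generating
  cylinders and used to change variables in integrals.\<close>

lemma is_haar_prob_iff_distr:
  "is_haar_prob V M \<longleftrightarrow> prob_space M \<and> (\<forall>G\<in>graphs V. distr M M (\<lambda>H. sym_diff G H) = M)"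
proof -
  have "(\<forall>A\<in>sets M. emeasure M ((\<lambda>H. sym_diff G H) ` A) = emeasure M A)
      \<longleftrightarrow> distr M M (\<lambda>H. sym_diff G H) = M" if G: "G \<in> graphs V" for G
  proof -
    have "emeasure M ((\<lambda>H. sym_diff G H) ` A) = emeasure (distr M M (\<lambda>H. sym_diff G H)) A"
      if "A \<in> sets M" for A
    proof -
      have "A \<subseteq> graphs V" using sets.sets_into_space[OF that] by (simp add: space_eq_graphs)
      have "(\<lambda>H. sym_diff G H) ` A = (\<lambda>H. sym_diff G H) -` A \<inter> space M"
        unfolding space_eq_graphs by (rule image_sym_diff[OF G \<open>A \<subseteq> graphs V\<close>])
      then show ?thesis
        by (simp add: emeasure_distr[OF measurable_sym_diff[OF G] that])
    qed
    then have "(\<forall>A\<in>sets M. emeasure M ((\<lambda>H. sym_diff G H) ` A) = emeasure M A)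
        \<longleftrightarrow> (\<forall>A\<in>sets M. emeasure (distr M M (\<lambda>H. sym_diff G H)) A = emeasure M A)"
      by simp
    also have "\<dots> \<longleftrightarrow> distr M M (\<lambda>H. sym_diff G H) = M"
    proof
      assume "\<forall>A\<in>sets M. emeasure (distr M M (\<lambda>H. sym_diff G H)) A = emeasure M A"
      then show "distr M M (\<lambda>H. sym_diff G H) = M" by (intro measure_eqI) simp_all
    qed (simp only:, simp)
    finally show ?thesis .
  qed
  then show ?thesis
    unfolding is_haar_prob_def sigma_sets_openin_graph_topology[OF countable_V]
    by (simp only: space_eq_graphs sets_M simp_thms cong: ball_cong)
qed

text \<open>The cylinders over \<open>F\<close> are translates of one another and partition the
  space, so the total mass 1 is shared equally among \<open>2 ^ card F\<close> of them.\<close>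

lemma haar_prob_cylinder:
  assumes haar: "is_haar_prob V M" and F: "finite F" "F \<subseteq> complete_graph V" and S: "S \<subseteq> F"
  shows "emeasure M (cylinder V F S) = ennreal ((1 / 2) ^ card F)"
proof -
  interpret prob_space M using haar unfolding is_haar_prob_def by blast
  have meas: "cylinder V F T \<in> sets M" if "T \<subseteq> F" for T
    unfolding sets_M using that F by (intro sigma_sets.Basic cylinders_I)
  have eq: "measure M (cylinder V F T) = measure M (cylinder V F {})" if T: "T \<subseteq> F" for T
  proof -
    have TG: "T \<in> graphs V" using T F by (auto simp: graphs_def)
    \<comment> \<open>Translation by \<open>T\<close> itself, seen as a graph, turns the empty trace
      into the trace \<open>T\<close>.\<close>
    have "(\<lambda>H. sym_diff T H) ` cylinder V F {} = cylinder V F T"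
    proof (subst image_sym_diff[OF TG])
      show "cylinder V F {} \<subseteq> graphs V" by (simp add: cylinder_def)
      show "(\<lambda>H. sym_diff T H) -` cylinder V F {} \<inter> graphs V = cylinder V F T"
        using vimage_sym_diff_cylinder[OF TG, of "{}" F] T by (simp add: Int_absorb2)
    qed
    moreover have "emeasure M ((\<lambda>H. sym_diff T H) ` cylinder V F {}) = emeasure M (cylinder V F {})"
      using haar TG meas[of "{}"] unfolding is_haar_prob_def by blast
    ultimately show ?thesis by (simp add: measure_def)
  qed
  have "1 = measure M (\<Union>T\<in>Pow F. cylinder V F T)"
  proof -
    have "G \<in> (\<Union>T\<in>Pow F. cylinder V F T)" if "G \<in> graphs V" for G
      using that by (intro UN_I[of "G \<inter> F"]) (simp_all add: cylinder_def)
    then have "(\<Union>T\<in>Pow F. cylinder V F T) = space M"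
      unfolding space_eq_graphs by (intro equalityI subsetI) (simp_all add: cylinder_def)
    then show ?thesis by (simp only: prob_space)
  qed
  also have "\<dots> = (\<Sum>T\<in>Pow F. measure M (cylinder V F T))"
    using F meas by (intro finite_measure_finite_Union) (auto simp: disjoint_family_on_def cylinder_def)
  also have "\<dots> = (\<Sum>T\<in>Pow F. measure M (cylinder V F S))"
    unfolding eq[OF S] by (intro sum.cong refl eq) simp
  also have "\<dots> = 2 ^ card F * measure M (cylinder V F S)"
    using F by (simp add: card_Pow)
  finally have "measure M (cylinder V F S) = 1 / 2 ^ card F"
    by (simp add: eq_divide_eq mult.commute)
  then show ?thesis
    by (simp add: emeasure_eq_measure power_one_over)
qed

end

text \<open>The values on cylinders are forced, and cylinders are an intersection-stable generator.
  The whole space is a cylinder, so a constant sequence serves as the exhausting one.\<close>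

lemma haar_prob_unique:
  assumes V: "countable V" and M: "is_haar_prob V M" and N: "is_haar_prob V N"
  shows "M = N"
proof (rule measure_eqI_generator_eq[OF Int_stable_cylinders cylinders_Pow])
  show sM: "sets M = sigma_sets (graphs V) (cylinders V)" and sN: "sets N = sigma_sets (graphs V) (cylinders V)"
    using M N unfolding is_haar_prob_def sigma_sets_openin_graph_topology[OF V] by blast+
  show "emeasure M X = emeasure N X" if "X \<in> cylinders V" for X
    using that
    by (cases rule: cylinders_E)
       (simp_all add: haar_prob_cylinder[OF V sM M] haar_prob_cylinder[OF V sN N])
  interpret prob_space M using M unfolding is_haar_prob_def by blast
  show "emeasure M ((\<lambda>_. graphs V) i) \<noteq> \<infinity>" for i :: nat by simp
qed (use graphs_in_cylinders in auto)

text \<open>The product of fair coins is pushed forward along the map \<open>t\<close> that collects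
  the edges marked true.\<close>

lemma haar_prob_exists:
  assumes V: "countable V"
  shows "\<exists>M. is_haar_prob V M"
proof -
  let ?K = "complete_graph V"
  define N where "N = (\<Pi>\<^sub>M e\<in>?K. measure_pmf (pmf_of_set (UNIV :: bool set)))"
  interpret N: product_prob_space "\<lambda>_. measure_pmf (pmf_of_set (UNIV :: bool set))" ?K
    by (rule product_prob_spaceI) (rule measure_pmf.prob_space_axioms)
  define t where "t = (\<lambda>f. {e \<in> ?K. f e})"
  define B where "B = measure_of (graphs V) (cylinders V) (\<lambda>_. 0)"
  define M where "M = distr N B t"
  have pre: "t -` cylinder V F S \<inter> space N = {f \<in> space N. \<forall>e\<in>F. f e \<in> {e \<in> S}}"
    if "F \<subseteq> ?K" "S \<subseteq> F" for F S
    using that by (auto simp: t_def cylinder_def graphs_def)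
  have meas: "{f \<in> space N. \<forall>e\<in>F. f e \<in> {e \<in> S}} \<in> sets N" if "finite F" "F \<subseteq> ?K" for F S
  proof -
    have "(\<lambda>f. f e) \<in> measurable N (measure_pmf (pmf_of_set (UNIV :: bool set)))" if "e \<in> F" for e
      unfolding N_def using that \<open>F \<subseteq> ?K\<close> by (intro measurable_component_singleton) auto
    then have "{f \<in> space N. f e \<in> {e \<in> S}} \<in> sets N" if "e \<in> F" for e
      using that measurable_sets[of "\<lambda>f. f e" N _ "{e \<in> S}"]
      by (simp add: vimage_def Int_def conj_commute)
    then show ?thesis using that by (intro sets.sets_Collect_finite_All) auto
  qed
  have t: "t \<in> measurable N B"
    unfolding B_def
  proof (rule measurable_measure_of[OF cylinders_Pow])
    show "t \<in> space N \<rightarrow> graphs V" by (auto simp: t_def graphs_def)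
    fix A assume "A \<in> cylinders V"
    then show "t -` A \<inter> space N \<in> sets N"
    proof (cases rule: cylinders_E)
      case (2 F S)
      then show ?thesis using meas[of F S] by (simp only: pre)
    qed simp
  qed
  have sets: "sets M = sigma_sets (graphs V) (cylinders V)"
    by (simp add: M_def B_def sets_measure_of[OF cylinders_Pow])
  have cyl: "emeasure M (cylinder V F S) = ennreal ((1 / 2) ^ card F)"
    if F: "finite F" "F \<subseteq> ?K" "S \<subseteq> F" for F S
  proof -
    have "cylinder V F S \<in> sets B"
      using F cylinders_I[OF F] by (auto simp: B_def sets_measure_of[OF cylinders_Pow])
    then have "emeasure M (cylinder V F S) = emeasure N {f \<in> space N. \<forall>e\<in>F. f e \<in> {e \<in> S}}"
      unfolding M_def by (simp add: emeasure_distr[OF t] pre F)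
    also have "\<dots> = (\<Prod>e\<in>F. emeasure (measure_pmf (pmf_of_set UNIV)) {e \<in> S})"
      unfolding N_def using F by (intro N.emeasure_PiM_Collect) auto
    also have "\<dots> = (\<Prod>e\<in>F. ennreal (1 / 2))"
      by (intro prod.cong refl) (simp add: emeasure_pmf_single)
    also have "\<dots> = ennreal ((1 / 2) ^ card F)"
      by (simp only: prod_constant) (rule ennreal_power, simp)
    finally show ?thesis .
  qed
  have prob: "prob_space M"
    unfolding M_def N_def[symmetric] using t N.P.prob_space_axioms
    by (intro prob_space.prob_space_distr) (simp_all add: N_def)
  have "distr M M (\<lambda>H. sym_diff G H) = M" if G: "G \<in> graphs V" for G
  proof (rule measure_eqI_generator_eq[OF Int_stable_cylinders cylinders_Pow])
    note m = measurable_sym_diff[OF V sets G]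
    fix A assume "A \<in> cylinders V"
    then show "emeasure (distr M M (\<lambda>H. sym_diff G H)) A = emeasure M A"
    proof (cases rule: cylinders_E)
      case (2 F S)
      have "A \<in> sets M" using \<open>A \<in> cylinders V\<close> by (simp add: sets)
      have "(\<lambda>H. sym_diff G H) -` A \<inter> space M = cylinder V F (sym_diff (G \<inter> F) S)"
        unfolding space_eq_graphs[OF V sets] 2(1) by (rule vimage_sym_diff_cylinder[OF G \<open>S \<subseteq> F\<close>])
      then have "emeasure (distr M M (\<lambda>H. sym_diff G H)) A = emeasure M (cylinder V F (sym_diff (G \<inter> F) S))"
        by (simp add: emeasure_distr[OF m \<open>A \<in> sets M\<close>])
      \<comment> \<open>Translation changes the prescribed trace but not the edge set
        \<open>F\<close>, and the measure depends on \<open>card F\<close> alone.\<close>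
      also have "\<dots> = emeasure M A"
      proof -
        have "sym_diff (G \<inter> F) S \<subseteq> F" using 2 by blast
        then show ?thesis unfolding 2(1) using 2 by (simp only: cyl)
      qed
      finally show ?thesis .
    qed simp
  next
    interpret prob_space "distr M M (\<lambda>H. sym_diff G H)"
      using prob measurable_sym_diff[OF V sets G] by (rule prob_space.prob_space_distr)
    show "emeasure (distr M M (\<lambda>H. sym_diff G H)) ((\<lambda>_. graphs V) i) \<noteq> \<infinity>" for i :: nat by simp
  qed (use graphs_in_cylinders sets in auto)
  then have "is_haar_prob V M"
    using prob by (simp add: is_haar_prob_iff_distr[OF V sets])
  then show ?thesis ..
qed

lemma is_haar_prob_haar_prob:
  assumes "countable V"
  shows "is_haar_prob V (haar_prob V)"
  unfolding haar_prob_def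
  using haar_prob_exists[OF assms] haar_prob_unique[OF assms] by (metis theI')

section \<open>Closures of subspaces of L2\<close>

lemma L2_I: "f \<in> borel_measurable M \<Longrightarrow> integrable M (\<lambda>x. (f x)\<^sup>2) \<Longrightarrow> f \<in> L2 M"
  by (simp add: L2_def)

lemma L2_measurable [measurable_dest]: "f \<in> L2 M \<Longrightarrow> f \<in> borel_measurable M"
  by (simp add: L2_def)

lemma L2_integrable: "f \<in> L2 M \<Longrightarrow> integrable M (\<lambda>x. (f x)\<^sup>2)"
  by (simp add: L2_def)

lemma L2_dominated:
  assumes f: "f \<in> L2 M" and g: "g \<in> borel_measurable M"
    and le: "\<And>x. x \<in> space M \<Longrightarrow> \<bar>g x\<bar> \<le> c * \<bar>f x\<bar>"
  shows "g \<in> L2 M"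
proof (rule L2_I[OF g], rule Bochner_Integration.integrable_bound)
  show "integrable M (\<lambda>x. c\<^sup>2 * (f x)\<^sup>2)" using L2_integrable[OF f] by simp
  show "AE x in M. norm ((g x)\<^sup>2) \<le> norm (c\<^sup>2 * (f x)\<^sup>2)"
  proof (rule AE_I2)
    fix x assume "x \<in> space M"
    from power_mono[OF le[OF this], of 2] show "norm ((g x)\<^sup>2) \<le> norm (c\<^sup>2 * (f x)\<^sup>2)"
      by (simp add: power_mult_distrib)
  qed
qed (use g in measurable)

lemma power2_add_le: "(a + b)\<^sup>2 \<le> 2 * a\<^sup>2 + 2 * (b::real)\<^sup>2"
  using zero_le_power2[of "a - b"] by (simp add: power2_eq_square algebra_simps)

lemma L2_add:
  assumes f: "f \<in> L2 M" and g: "g \<in> L2 M"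
  shows "(\<lambda>x. f x + g x) \<in> L2 M"
proof (rule L2_I, use f g in measurable, rule Bochner_Integration.integrable_bound)
  show "integrable M (\<lambda>x. 2 * (f x)\<^sup>2 + 2 * (g x)\<^sup>2)"
    using L2_integrable[OF f] L2_integrable[OF g] by simp
  show "AE x in M. norm ((f x + g x)\<^sup>2) \<le> norm (2 * (f x)\<^sup>2 + 2 * (g x)\<^sup>2)"
    using power2_add_le by (intro AE_I2) simp
qed (use f g in measurable)

lemma L2_cmult: "f \<in> L2 M \<Longrightarrow> (\<lambda>x. c * f x) \<in> L2 M"
  by (rule L2_dominated[where c="\<bar>c\<bar>"]) (auto simp: abs_mult)

lemma L2_diff: "f \<in> L2 M \<Longrightarrow> g \<in> L2 M \<Longrightarrow> (\<lambda>x. f x - g x) \<in> L2 M"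
  using L2_add[OF _ L2_cmult[of g M "-1"], of f] by simp

lemma (in finite_measure) L2_bounded:
  assumes "f \<in> borel_measurable M" and "\<And>x. x \<in> space M \<Longrightarrow> \<bar>f x\<bar> \<le> B"
  shows "f \<in> L2 M"
proof -
  have "(\<lambda>_. 1 :: real) \<in> L2 M" by (rule L2_I) auto
  then show ?thesis
    by (rule L2_dominated[where c=B]) (use assms in simp_all)
qed

text \<open>A triangle inequality for squared distances, up to a factor 2. It suffices for
  approximation arguments and avoids square roots and the Minkowski inequality.\<close>

lemma L2_sqdist_triangle:
  assumes f: "f \<in> L2 M" and g: "g \<in> L2 M" and h: "h \<in> L2 M"
  shows "(\<integral>x. (f x - h x)\<^sup>2 \<partial>M) \<le> 2 * (\<integral>x. (f x - g x)\<^sup>2 \<partial>M) + 2 * (\<integral>x. (g x - h x)\<^sup>2 \<partial>M)"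
proof -
  have i: "integrable M (\<lambda>x. (f x - g x)\<^sup>2)" "integrable M (\<lambda>x. (g x - h x)\<^sup>2)"
    "integrable M (\<lambda>x. (f x - h x)\<^sup>2)"
    using f g h by (auto intro: L2_integrable L2_diff)
  have "(\<integral>x. (f x - h x)\<^sup>2 \<partial>M) \<le> (\<integral>x. 2 * (f x - g x)\<^sup>2 + 2 * (g x - h x)\<^sup>2 \<partial>M)"
  proof (rule integral_mono)
    show "(f x - h x)\<^sup>2 \<le> 2 * (f x - g x)\<^sup>2 + 2 * (g x - h x)\<^sup>2" for x
      using power2_add_le[of "f x - g x" "g x - h x"] by simp
  qed (use i in auto)
  then show ?thesis using i by simp
qed

text \<open>In the application \<open>S\<close> consists of the Walsh polynomials. Finiteness of the
  measure puts bounded measurable functions, in particular indicators, into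
  \<open>L2 M\<close>.\<close>

locale L2_subspace = finite_measure M for M :: "'x measure" +
  fixes S :: "('x \<Rightarrow> real) set"
  assumes S_L2: "S \<subseteq> L2 M"
    and S_add: "f \<in> S \<Longrightarrow> g \<in> S \<Longrightarrow> (\<lambda>x. f x + g x) \<in> S"
    and S_cmult: "f \<in> S \<Longrightarrow> (\<lambda>x. c * f x) \<in> S"
begin

text \<open>The closure of \<open>S\<close> in \<open>L2 M\<close>, expressed through squared
  distances to match \<open>L2_sqdist_triangle\<close>.\<close>

definition cl :: "('x \<Rightarrow> real) set" where
  "cl = {f \<in> L2 M. \<forall>\<epsilon>>0. \<exists>s\<in>S. (\<integral>x. (f x - s x)\<^sup>2 \<partial>M) < \<epsilon>}"

lemma cl_L2: "f \<in> cl \<Longrightarrow> f \<in> L2 M"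
  by (simp add: cl_def)

lemma cl_approx:
  assumes "f \<in> cl" "\<epsilon> > 0"
  obtains s where "s \<in> S" "(\<integral>x. (f x - s x)\<^sup>2 \<partial>M) < \<epsilon>"
  using assms by (auto simp: cl_def)

lemma subset_cl: "f \<in> S \<Longrightarrow> f \<in> cl"
  using S_L2 by (auto simp: cl_def intro!: bexI[of _ f])

lemma cl_closed:
  assumes f: "f \<in> L2 M" and approx: "\<And>\<epsilon>. \<epsilon> > 0 \<Longrightarrow> \<exists>g\<in>cl. (\<integral>x. (f x - g x)\<^sup>2 \<partial>M) < \<epsilon>"
  shows "f \<in> cl"
  unfolding cl_def
proof (clarsimp simp: f)
  fix \<epsilon> :: real assume "\<epsilon> > 0"
  \<comment> \<open>The factor 2 in \<open>L2_sqdist_triangle\<close> doubles each of the two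
    errors, hence a quarter for each.\<close>
  with approx[of "\<epsilon> / 4"] obtain g where g: "g \<in> cl" "(\<integral>x. (f x - g x)\<^sup>2 \<partial>M) < \<epsilon> / 4" by auto
  from cl_approx[OF g(1), of "\<epsilon> / 4"] \<open>\<epsilon> > 0\<close> obtain s
    where s: "s \<in> S" "(\<integral>x. (g x - s x)\<^sup>2 \<partial>M) < \<epsilon> / 4" by auto
  have "(\<integral>x. (f x - s x)\<^sup>2 \<partial>M) < \<epsilon>"
    using L2_sqdist_triangle[OF f cl_L2[OF g(1)] subsetD[OF S_L2 s(1)]] g s by linarith
  with s show "\<exists>s\<in>S. (\<integral>x. (f x - s x)\<^sup>2 \<partial>M) < \<epsilon>" by blast
qed

text \<open>Elements of \<open>cl\<close> are functions on the whole type, whereas the identities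
  used later hold only on \<open>space M\<close>.\<close>

lemma cl_cong:
  assumes f: "f \<in> cl" and eq: "\<And>x. x \<in> space M \<Longrightarrow> g x = f x"
  shows "g \<in> cl"
proof (rule cl_closed)
  have "g \<in> borel_measurable M"
    using L2_measurable[OF cl_L2[OF f]] by (subst measurable_cong[of M g f]) (auto simp: eq)
  then show "g \<in> L2 M"
    by (rule L2_dominated[OF cl_L2[OF f], where c=1]) (simp add: eq)
  show "\<exists>h\<in>cl. (\<integral>x. (g x - h x)\<^sup>2 \<partial>M) < \<epsilon>" if "\<epsilon> > 0" for \<epsilon>
  proof (rule bexI[OF _ f])
    have "(\<integral>x. (g x - f x)\<^sup>2 \<partial>M) = (\<integral>x. 0 \<partial>M)"
      by (rule Bochner_Integration.integral_cong) (simp_all add: eq)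
    with that show "(\<integral>x. (g x - f x)\<^sup>2 \<partial>M) < \<epsilon>" by simp
  qed
qed

lemma cl_add:
  assumes f: "f \<in> cl" and g: "g \<in> cl"
  shows "(\<lambda>x. f x + g x) \<in> cl"
  unfolding cl_def
proof (clarsimp simp: L2_add[OF cl_L2[OF f] cl_L2[OF g]])
  fix \<epsilon> :: real assume "\<epsilon> > 0"
  obtain s where s: "s \<in> S" "(\<integral>x. (f x - s x)\<^sup>2 \<partial>M) < \<epsilon> / 4"
    using cl_approx[OF f, of "\<epsilon> / 4"] \<open>\<epsilon> > 0\<close> by auto
  obtain t where t: "t \<in> S" "(\<integral>x. (g x - t x)\<^sup>2 \<partial>M) < \<epsilon> / 4"
    using cl_approx[OF g, of "\<epsilon> / 4"] \<open>\<epsilon> > 0\<close> by auto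
  have L: "f \<in> L2 M" "g \<in> L2 M" "s \<in> L2 M" "t \<in> L2 M"
    using cl_L2 f g s t S_L2 by auto
  have "(\<integral>x. (f x + g x - (s x + t x))\<^sup>2 \<partial>M)
      \<le> 2 * (\<integral>x. (f x + g x - (s x + g x))\<^sup>2 \<partial>M) + 2 * (\<integral>x. (s x + g x - (s x + t x))\<^sup>2 \<partial>M)"
    by (rule L2_sqdist_triangle) (intro L2_add L)+
  also have "\<dots> < \<epsilon>" using s t by simp
  finally show "\<exists>s\<in>S. (\<integral>x. (f x + g x - s x)\<^sup>2 \<partial>M) < \<epsilon>"
    using S_add[OF s(1) t(1)] by (intro bexI)
qed

lemma cl_cmult:
  assumes f: "f \<in> cl"
  shows "(\<lambda>x. c * f x) \<in> cl"
  unfolding cl_def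
proof (clarsimp simp: L2_cmult[OF cl_L2[OF f]])
  fix \<epsilon> :: real assume "\<epsilon> > 0"
  \<comment> \<open>Adding 1 keeps the denominator positive when \<open>c = 0\<close>.\<close>
  moreover have c: "c\<^sup>2 + 1 > 0" by (simp add: add_nonneg_pos)
  ultimately obtain s where s: "s \<in> S" "(\<integral>x. (f x - s x)\<^sup>2 \<partial>M) < \<epsilon> / (c\<^sup>2 + 1)"
    using cl_approx[OF f, of "\<epsilon> / (c\<^sup>2 + 1)"] by auto
  have "(\<integral>x. (c * f x - c * s x)\<^sup>2 \<partial>M) = c\<^sup>2 * (\<integral>x. (f x - s x)\<^sup>2 \<partial>M)"
    by (simp add: power_mult_distrib flip: right_diff_distrib)
  also have "\<dots> \<le> (c\<^sup>2 + 1) * (\<integral>x. (f x - s x)\<^sup>2 \<partial>M)"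
    by (intro mult_right_mono) auto
  also have "\<dots> < \<epsilon>" using s c by (simp add: pos_less_divide_eq mult.commute)
  finally show "\<exists>s\<in>S. (\<integral>x. (c * f x - s x)\<^sup>2 \<partial>M) < \<epsilon>"
    using S_cmult[OF s(1)] by (intro bexI)
qed

lemma cl_zero:
  assumes "f \<in> cl"
  shows "(\<lambda>x. 0) \<in> cl"
  using cl_cmult[OF assms, of 0] by simp

text \<open>The index set is nonempty because the locale admits an empty \<open>S\<close>, whose
  closure does not contain the zero function.\<close>

lemma cl_sum:
  assumes "finite I" "I \<noteq> {}" "\<And>i. i \<in> I \<Longrightarrow> f i \<in> cl"
  shows "(\<lambda>x. \<Sum>i\<in>I. f i x) \<in> cl"
  using assms by (induction I rule: finite_ne_induct) (auto intro: cl_add)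

text \<open>Dominated convergence applied to the squared differences: the bound on
  \<open>g i\<close> gives \<open>\<bar>f x - g i x\<bar> \<le> 3 * \<bar>f x\<bar>\<close>, whence
  the integrable majorant \<open>9 * (f x)\<^sup>2\<close>.\<close>

lemma cl_dominated_limit:
  assumes g: "\<And>i. g i \<in> cl" and f: "f \<in> L2 M"
    and lim: "\<And>x. x \<in> space M \<Longrightarrow> (\<lambda>i. g i x) \<longlonglongrightarrow> f x"
    and le: "\<And>i x. x \<in> space M \<Longrightarrow> \<bar>g i x\<bar> \<le> 2 * \<bar>f x\<bar>"
  shows "f \<in> cl"
proof (rule cl_closed[OF f])
  fix \<epsilon> :: real assume "\<epsilon> > 0"
  have "(\<lambda>i. \<integral>x. (f x - g i x)\<^sup>2 \<partial>M) \<longlonglongrightarrow> (\<integral>x. 0 \<partial>M)"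
  proof (rule integral_dominated_convergence)
    show "integrable M (\<lambda>x. 9 * (f x)\<^sup>2)" using L2_integrable[OF f] by simp
    show "(\<lambda>x. (f x - g i x)\<^sup>2) \<in> borel_measurable M" for i
      using L2_measurable[OF f] L2_measurable[OF cl_L2[OF g]] by measurable
    show "AE x in M. (\<lambda>i. (f x - g i x)\<^sup>2) \<longlonglongrightarrow> 0"
    proof (rule AE_I2)
      fix x assume "x \<in> space M"
      from tendsto_power[OF tendsto_diff[OF tendsto_const[of "f x"] lim[OF this]], of 2]
      show "(\<lambda>i. (f x - g i x)\<^sup>2) \<longlonglongrightarrow> 0" by simp
    qed
    show "AE x in M. norm ((f x - g i x)\<^sup>2) \<le> 9 * (f x)\<^sup>2" for i
    proof (rule AE_I2)
      fix x assume "x \<in> space M"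
      then have "\<bar>f x - g i x\<bar> \<le> 3 * \<bar>f x\<bar>" using le[of x i] by linarith
      from power_mono[OF this, of 2] show "norm ((f x - g i x)\<^sup>2) \<le> 9 * (f x)\<^sup>2"
        by (simp add: power_mult_distrib)
    qed
  qed simp
  then have "eventually (\<lambda>i. (\<integral>x. (f x - g i x)\<^sup>2 \<partial>M) < \<epsilon>) sequentially"
    using \<open>\<epsilon> > 0\<close> by (simp add: order_tendstoD)
  then obtain i where "(\<integral>x. (f x - g i x)\<^sup>2 \<partial>M) < \<epsilon>" by (auto simp: eventually_sequentially)
  with g show "\<exists>g\<in>cl. (\<integral>x. (f x - g x)\<^sup>2 \<partial>M) < \<epsilon>" by blast
qed

lemma L2_indicator: "A \<in> sets M \<Longrightarrow> indicator A \<in> L2 M"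
  by (rule L2_bounded[where B=1]) (auto simp: indicator_def)

text \<open>Dynkin's argument: complements come from subtracting from the indicator of \<Omega>, and
  disjoint unions from dominated limits of partial sums.\<close>

lemma indicator_cl:
  assumes gen: "sets M = sigma_sets \<Omega> E" "E \<subseteq> Pow \<Omega>" "Int_stable E"
    and E: "\<And>A. A \<in> E \<Longrightarrow> indicator A \<in> cl" and \<Omega>: "indicator \<Omega> \<in> cl"
    and A: "A \<in> sets M"
  shows "indicator A \<in> cl"
  using gen(3,2) A[unfolded gen(1)]
proof (induction rule: sigma_sets_induct_disjoint)
  case (basic A)
  then show ?case by (rule E)
next
  case empty
  then show ?case using cl_zero[OF \<Omega>] by (simp add: indicator_def[abs_def])
next
  case (compl A)
  have "A \<subseteq> \<Omega>" using compl(1) gen(2) sigma_sets_into_sp by blast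
  then show ?case
    by (intro cl_cong[OF cl_add[OF \<Omega> cl_cmult[OF compl(2), of "-1"]]])
       (auto simp: indicator_def)
next
  case (union A)
  have disj: "i \<noteq> j \<Longrightarrow> A i \<inter> A j = {}" for i j
    using union(1) by (auto simp: disjoint_family_on_def)
  have sums: "(\<lambda>i. indicator (A i) x :: real) sums indicator (\<Union>i. A i) x" for x
    using disj by (rule indicator_sums)
  show ?case
  proof (rule cl_dominated_limit)
    \<comment> \<open>\<open>Suc n\<close> keeps the index set nonempty, as \<open>cl_sum\<close>
      requires.\<close>
    show "(\<lambda>x. \<Sum>i<Suc n. indicator (A i) x) \<in> cl" for n
      using union(3) by (intro cl_sum) auto
    have "(\<Union>i. A i) \<in> sets M" using union(2) gen(1) by (intro sets.countable_UN) auto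
    then show "indicator (\<Union>i. A i) \<in> L2 M" by (rule L2_indicator)
    show "(\<lambda>n. \<Sum>i<Suc n. indicator (A i) x) \<longlonglongrightarrow> (indicator (\<Union>i. A i) x :: real)" for x
      using sums[of x] unfolding sums_def by (rule LIMSEQ_Suc)
    show "\<bar>\<Sum>i<Suc n. indicator (A i) x\<bar> \<le> 2 * \<bar>indicator (\<Union>i. A i) x :: real\<bar>" for n x
    proof -
      have "(\<Sum>i<Suc n. indicator (A i) x :: real) \<le> indicator (\<Union>i. A i) x"
        using sum_le_suminf[OF sums_summable[OF sums[of x]], of "{..<Suc n}"] sums_unique[OF sums[of x]]
        by simp
      moreover have "0 \<le> (\<Sum>i<Suc n. indicator (A i) x :: real)" by (intro sum_nonneg) simp
      ultimately show ?thesis by linarith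
    qed
  qed
qed

lemma simple_function_cl:
  fixes f :: "'x \<Rightarrow> real"
  assumes ind: "\<And>A. A \<in> sets M \<Longrightarrow> indicator A \<in> cl" and f: "simple_function M f"
  shows "f \<in> cl"
\<comment> \<open>On an empty space the representation by indicators is an empty sum, outside the
  reach of \<open>cl_sum\<close>; there every function agrees with any element of \<open>cl\<close>
  on the space.\<close>
proof (cases "space M = {}")
  case True
  then show ?thesis by (intro cl_cong[OF ind[of "{}"]]) simp_all
next
  case False
  have "(\<lambda>x. \<Sum>y\<in>f ` space M. y * indicator (f -` {y} \<inter> space M) x) \<in> cl"
    using f False
    by (intro cl_sum cl_cmult ind) (auto simp: simple_function_def)
  then show ?thesis
    by (rule cl_cong) (subst simple_function_indicator_representation_banach[OF f], auto simp: mult.commute)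
qed

text \<open>A measurable \<open>f\<close> is a pointwise limit of simple functions bounded by
  \<open>2 * \<bar>f x\<bar>\<close>, exactly the bound in
  \<open>cl_dominated_limit\<close>.\<close>

lemma L2_subset_cl:
  assumes ind: "\<And>A. A \<in> sets M \<Longrightarrow> indicator A \<in> cl" and f: "f \<in> L2 M"
  shows "f \<in> cl"
proof -
  from borel_measurable_implies_sequence_metric[OF L2_measurable[OF f], of 0] obtain s where
    s: "\<And>i. simple_function M (s i)" "\<And>x. x \<in> space M \<Longrightarrow> (\<lambda>i. s i x) \<longlonglongrightarrow> f x"
    "\<And>i x. x \<in> space M \<Longrightarrow> \<bar>s i x\<bar> \<le> 2 * \<bar>f x\<bar>"
    by (simp add: dist_norm) metis
  show ?thesis
    using simple_function_cl[OF ind s(1)] f s(2,3) by (rule cl_dominated_limit)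
qed

end

section \<open>The Walsh basis\<close>

text \<open>Fourier expansion of a point mass on the group of subsets of \<open>F\<close>:
  orthogonality at the symmetric difference of \<open>S\<close> and \<open>G\<close> singles out the
  graphs with trace \<open>S\<close>.\<close>

lemma indicator_cylinder:
  assumes F: "finite F" and S: "S \<subseteq> F" and G: "G \<in> graphs V"
  shows "indicator (cylinder V F S) G = (\<Sum>H\<in>Pow F. chi H S / 2 ^ card F * chi H G)"
proof -
  have "(\<Sum>H\<in>Pow F. chi H S * chi H G) = (\<Sum>H\<in>Pow F. chi H (sym_diff S G))"
  proof (rule sum.cong[OF refl])
    fix H assume "H \<in> Pow F"
    then have "finite H" using F by (auto intro: finite_subset)
    then show "chi H S * chi H G = chi H (sym_diff S G)" by (rule chi_sym_diff[symmetric])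
  qed
  also have "\<dots> = (if F \<inter> sym_diff S G = {} then 2 ^ card F else 0)"
    by (rule sum_Pow_chi[OF F])
  also have "F \<inter> sym_diff S G = {} \<longleftrightarrow> G \<inter> F = S" using S by blast
  finally have "(\<Sum>H\<in>Pow F. chi H S * chi H G) = (if G \<inter> F = S then 2 ^ card F else 0)" .
  then have "(\<Sum>H\<in>Pow F. chi H S * chi H G) / 2 ^ card F = indicator (cylinder V F S) G"
    using G by (simp add: cylinder_def indicator_def)
  then show ?thesis by (simp add: sum_divide_distrib)
qed

text \<open>Padding both coefficient families by zeros to a common index set shows that the Walsh
  polynomials are closed under addition.\<close>

lemma sum_scaled_common_index:
  fixes c :: "'i \<Rightarrow> real"
  assumes "finite F" "finite F'"
  shows "(\<Sum>i\<in>F. c i * w i) + (\<Sum>i\<in>F'. d i * w i)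
    = (\<Sum>i\<in>F \<union> F'. ((if i \<in> F then c i else 0) + (if i \<in> F' then d i else 0)) * w i)"
proof -
  have "(\<Sum>i\<in>F. c i * w i) = (\<Sum>i\<in>F \<union> F'. (if i \<in> F then c i else 0) * w i)"
    using assms by (intro sum.mono_neutral_cong_left) auto
  moreover have "(\<Sum>i\<in>F'. d i * w i) = (\<Sum>i\<in>F \<union> F'. (if i \<in> F' then d i else 0) * w i)"
    using assms by (intro sum.mono_neutral_cong_left) auto
  ultimately show ?thesis by (simp add: sum.distrib distrib_right)
qed

section \<open>Integrals, orthonormality and density of the Walsh functions\<close>

context
  fixes V :: "'a set" and M :: "'a set set measure"
  assumes countable_V: "countable V" and haar: "is_haar_prob V M"
begin

interpretation prob_space M
  using haar unfolding is_haar_prob_def by blast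

lemma sets_haar: "sets M = sigma_sets (graphs V) (cylinders V)"
  using haar unfolding is_haar_prob_def sigma_sets_openin_graph_topology[OF countable_V] by blast

lemma space_haar: "space M = graphs V"
  using haar unfolding is_haar_prob_def by blast

text \<open>The function is constant on each of the finitely many cylinders over \<open>E\<close>,
  hence a finite combination of their indicators.\<close>

lemma chi_measurable:
  assumes E: "E \<in> finite_graphs V"
  shows "chi E \<in> borel_measurable M"
proof -
  have E: "finite E" "E \<subseteq> complete_graph V" using E by (simp_all add: finite_graphs_iff)
  have "(\<lambda>G. \<Sum>S\<in>Pow E. chi E S * indicator (cylinder V E S) G) \<in> borel_measurable M"
  proof (intro borel_measurable_sum borel_measurable_times borel_measurable_indicator)
    fix S assume "S \<in> Pow E"
    then show "cylinder V E S \<in> sets M"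
      unfolding sets_haar using E by (intro sigma_sets.Basic cylinders_I) simp_all
  qed simp
  moreover have "chi E G = (\<Sum>S\<in>Pow E. chi E S * indicator (cylinder V E S) G)"
    if "G \<in> space M" for G
  proof -
    have "(\<Sum>S\<in>Pow E. chi E S * indicator (cylinder V E S) G)
        = (\<Sum>S\<in>Pow E. if S = G \<inter> E then chi E S else 0)"
      using that by (intro sum.cong) (auto simp: cylinder_def space_haar indicator_def)
    also have "\<dots> = chi E (G \<inter> E)" using E by (simp add: sum.delta)
    also have "\<dots> = chi E G" by (simp add: chi_def Int_left_commute Int_commute)
    finally show ?thesis by simp
  qed
  ultimately show ?thesis by (subst measurable_cong) simp_all
qed

text \<open>Translating by a single edge of \<open>E\<close> flips the sign of \<open>chi E\<close>,
  so by invariance the integral equals its own negative.\<close>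

lemma integral_chi:
  assumes E: "E \<in> finite_graphs V"
  shows "(\<integral>G. chi E G \<partial>M) = (if E = {} then 1 else 0)"
proof (cases "E = {}")
  case False
  then obtain e where e: "e \<in> E" by blast
  have fin: "finite E" and eG: "{e} \<in> graphs V"
    using E e by (auto simp: finite_graphs_iff graphs_def)
  have "distr M M (\<lambda>H. sym_diff {e} H) = M"
    using haar eG is_haar_prob_iff_distr[OF countable_V sets_haar] by blast
  then have "(\<integral>G. chi E G \<partial>M) = (\<integral>G. chi E G \<partial>(distr M M (\<lambda>H. sym_diff {e} H)))" by simp
  also have "\<dots> = (\<integral>G. chi E (sym_diff {e} G) \<partial>M)"
    by (rule integral_distr[OF measurable_sym_diff[OF countable_V sets_haar eG] chi_measurable[OF E]])
  also have "\<dots> = (\<integral>G. - chi E G \<partial>M)"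
    unfolding chi_sym_diff[OF fin] using e by (simp add: chi_singleton)
  finally show ?thesis using False by simp
qed (simp add: prob_space)

lemma haar_walsh_orthonormal_basis:
  "L2_orthonormal_basis M (finite_graphs V) (\<lambda>E G. Re (walsh V E G))"
proof -
  let ?w = "\<lambda>E G. Re (walsh V E G)"
  \<comment> \<open>Agreement is asserted only on the space, because \<open>walsh V E\<close> is
    \<open>undefined\<close> off \<open>graphs V\<close>.\<close>
  have w: "?w E G = chi E G" if "G \<in> space M" for E G
    using that by (simp add: walsh_eq_chi space_haar)
  have w_meas: "?w E \<in> borel_measurable M" if "E \<in> finite_graphs V" for E
    using chi_measurable[OF that] by (subst measurable_cong[OF w]) simp_all
  have w_L2: "?w E \<in> L2 M" if "E \<in> finite_graphs V" for E
    using w_meas[OF that] by (rule L2_bounded[where B=1]) (simp add: w)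
  have ortho: "L2_inner M (?w E) (?w F) = (if E = F then 1 else 0)"
    if "E \<in> finite_graphs V" "F \<in> finite_graphs V" for E F
  proof -
    have fin: "finite E" "finite F" and EF: "sym_diff E F \<in> finite_graphs V"
      using that by (auto simp: finite_graphs_iff)
    \<comment> \<open>The product of two Walsh functions is the Walsh function of the symmetric
      difference, so orthonormality reduces to \<open>integral_chi\<close>.\<close>
    have "L2_inner M (?w E) (?w F) = (\<integral>G. chi (sym_diff E F) G \<partial>M)"
      unfolding L2_inner_def chi_sym_diff_left[OF fin]
      by (rule Bochner_Integration.integral_cong) (simp_all add: w)
    also have "\<dots> = (if sym_diff E F = {} then 1 else 0)" by (rule integral_chi[OF EF])
    also have "sym_diff E F = {} \<longleftrightarrow> E = F" by blast
    finally show ?thesis .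
  qed
  define S where "S = {\<lambda>x. \<Sum>E\<in>F. c E * ?w E x | F c. finite F \<and> F \<subseteq> finite_graphs V}"
  have S_I: "(\<lambda>x. \<Sum>E\<in>F. c E * ?w E x) \<in> S" if "finite F" "F \<subseteq> finite_graphs V" for F c
    unfolding S_def using that by blast
  interpret L2_subspace M S
  proof
    show "S \<subseteq> L2 M"
    proof
      fix f assume "f \<in> S"
      then obtain F c where F: "finite F" "F \<subseteq> finite_graphs V" and f: "f = (\<lambda>x. \<Sum>E\<in>F. c E * ?w E x)"
        unfolding S_def by blast
      have "(\<lambda>x. \<Sum>E\<in>F. c E * ?w E x) \<in> L2 M"
        using F
      proof (induction F)
        case empty
        then show ?case by (simp add: L2_def)
      next
        case (insert E F)
        then show ?case using L2_add[OF L2_cmult[OF w_L2]] by simp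
      qed
      then show "f \<in> L2 M" by (simp only: f)
    qed
  next
    fix f g assume "f \<in> S" "g \<in> S"
    then obtain F c F' d where F: "finite F" "F \<subseteq> finite_graphs V" "f = (\<lambda>x. \<Sum>E\<in>F. c E * ?w E x)"
      and F': "finite F'" "F' \<subseteq> finite_graphs V" "g = (\<lambda>x. \<Sum>E\<in>F'. d E * ?w E x)"
      unfolding S_def by blast
    show "(\<lambda>x. f x + g x) \<in> S"
      unfolding F(3) F'(3) sum_scaled_common_index[OF F(1) F'(1)]
      using F F' by (intro S_I) simp_all
  next
    fix f and a :: real assume "f \<in> S"
    then obtain F c where F: "finite F" "F \<subseteq> finite_graphs V" "f = (\<lambda>x. \<Sum>E\<in>F. c E * ?w E x)"
      unfolding S_def by blast
    have "(\<lambda>x. a * f x) = (\<lambda>x. \<Sum>E\<in>F. (a * c E) * ?w E x)"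
      unfolding F(3) by (simp add: sum_distrib_left mult.assoc)
    then show "(\<lambda>x. a * f x) \<in> S" using S_I[OF F(1,2)] by simp
  qed
  have cyl: "indicator (cylinder V F T) \<in> cl"
    if F: "finite F" "F \<subseteq> complete_graph V" "T \<subseteq> F" for F T
  proof (rule cl_cong)
    have "finite (Pow F)" "Pow F \<subseteq> finite_graphs V"
      using F by (simp, meson PowD finite_graphs_iff finite_subset order_trans subsetI)
    then have "(\<lambda>G. \<Sum>H\<in>Pow F. chi H T / 2 ^ card F * ?w H G) \<in> S"
      by (rule S_I)
    then show "(\<lambda>G. \<Sum>H\<in>Pow F. chi H T / 2 ^ card F * ?w H G) \<in> cl" by (rule subset_cl)
    show "indicator (cylinder V F T) G = (\<Sum>H\<in>Pow F. chi H T / 2 ^ card F * ?w H G)"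
      if "G \<in> space M" for G
      using that indicator_cylinder[OF F(1,3)] by (simp add: w space_haar)
  qed
  have zero: "indicator {} \<in> cl"
    using cl_zero[OF cyl[of "{}" "{}"]] by (simp add: indicator_def[abs_def])
  have ind: "indicator A \<in> cl" if "A \<in> sets M" for A
    using sets_haar cylinders_Pow Int_stable_cylinders _ _ that
  proof (rule indicator_cl)
    show "indicator A \<in> cl" if "A \<in> cylinders V" for A
      using that by (cases rule: cylinders_E) (simp_all add: zero cyl)
    show "indicator (graphs V) \<in> cl"
      unfolding graphs_cylinder by (rule cyl) simp_all
  qed
  have dense: "\<exists>F c. finite F \<and> F \<subseteq> finite_graphs V \<and>
      L2_norm M (\<lambda>x. f x - (\<Sum>E\<in>F. c E * ?w E x)) < \<epsilon>" if "f \<in> L2 M" "\<epsilon> > 0" for f \<epsilon>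
  proof -
    have "\<epsilon>\<^sup>2 > 0" using that by simp
    with L2_subset_cl[OF ind that(1)] obtain s where "s \<in> S" and s: "(\<integral>x. (f x - s x)\<^sup>2 \<partial>M) < \<epsilon>\<^sup>2"
      by (rule cl_approx)
    then obtain F c where F: "finite F" "F \<subseteq> finite_graphs V" "s = (\<lambda>x. \<Sum>E\<in>F. c E * ?w E x)"
      unfolding S_def by blast
    have "L2_norm M (\<lambda>x. f x - s x) < \<epsilon>"
      unfolding L2_norm_def L2_inner_def power2_eq_square[symmetric]
      using s that by (intro real_less_lsqrt) simp_all
    with F show ?thesis by blast
  qed
  show ?thesis
    unfolding L2_orthonormal_basis_def using w_L2 ortho dense by simp
qed

end

section \<open>Fourier coefficients on finite edge sets\<close>

text \<open>Fourier transform on the group \<open>Pow F\<close> under symmetric difference, divided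
  by the order of the group so that inversion carries no factor and the coefficients act as weights
  on the subsets \<open>H\<close>.\<close>

definition fourier :: "('e set \<Rightarrow> real) \<Rightarrow> 'e set \<Rightarrow> 'e set \<Rightarrow> real" where
  "fourier g F H = (\<Sum>A\<in>Pow F. g A * chi H A) / 2 ^ card F"

lemma fourier_inversion:
  assumes F: "finite F" and G: "G \<subseteq> F"
  shows "(\<Sum>H\<in>Pow F. fourier g F H * chi H G) = g G"
proof -
  have "(\<Sum>H\<in>Pow F. fourier g F H * chi H G)
      = (\<Sum>H\<in>Pow F. \<Sum>A\<in>Pow F. g A / 2 ^ card F * chi H (sym_diff A G))"
  proof (rule sum.cong[OF refl])
    fix H assume "H \<in> Pow F"
    then have "finite H" using F by (simp add: finite_subset)
    then show "fourier g F H * chi H G = (\<Sum>A\<in>Pow F. g A / 2 ^ card F * chi H (sym_diff A G))"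
      unfolding fourier_def chi_sym_diff[OF \<open>finite H\<close>]
      by (simp add: sum_divide_distrib sum_distrib_left mult_ac)
  qed
  also have "\<dots> = (\<Sum>A\<in>Pow F. g A / 2 ^ card F * (\<Sum>H\<in>Pow F. chi H (sym_diff A G)))"
    by (subst sum.swap) (simp only: sum_distrib_left)
  also have "\<dots> = (\<Sum>A\<in>Pow F. if A = G then g A else 0)"
  proof (rule sum.cong[OF refl])
    fix A assume "A \<in> Pow F"
    then have "F \<inter> sym_diff A G = {} \<longleftrightarrow> A = G" using G by blast
    then show "g A / 2 ^ card F * (\<Sum>H\<in>Pow F. chi H (sym_diff A G)) = (if A = G then g A else 0)"
      unfolding sum_Pow_chi[OF F] by simp
  qed
  also have "\<dots> = g G" using F G by simp
  finally show ?thesis .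
qed

text \<open>The weights over \<open>F\<close> are the marginals of those over \<open>F'\<close>:
  expand \<open>g\<close> on \<open>Pow F\<close> by inversion over \<open>F'\<close>, then let
  orthogonality over \<open>Pow F\<close> select the \<open>H'\<close> with trace
  \<open>H\<close>.\<close>

lemma fourier_restrict:
  assumes F': "finite F'" and sub: "F \<subseteq> F'" and H: "H \<subseteq> F"
  shows "fourier g F H = (\<Sum>H' | H' \<in> Pow F' \<and> H' \<inter> F = H. fourier g F' H')"
proof -
  have F: "finite F" using F' sub by (rule rev_finite_subset)
  have "(\<Sum>A\<in>Pow F. g A * chi H A)
      = (\<Sum>A\<in>Pow F. \<Sum>H'\<in>Pow F'. fourier g F' H' * chi A (sym_diff H' H))"
  proof (rule sum.cong[OF refl])
    fix A assume "A \<in> Pow F"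
    then have A: "A \<subseteq> F'" "finite A" using F sub by (auto simp: finite_subset)
    show "g A * chi H A = (\<Sum>H'\<in>Pow F'. fourier g F' H' * chi A (sym_diff H' H))"
      unfolding fourier_inversion[OF F' A(1), of g, symmetric] sum_distrib_right
        chi_sym_diff[OF A(2)]
      by (simp add: chi_commute mult_ac)
  qed
  also have "\<dots> = (\<Sum>H'\<in>Pow F'. fourier g F' H' * (\<Sum>A\<in>Pow F. chi A (sym_diff H' H)))"
    by (subst sum.swap) (simp only: sum_distrib_left)
  also have "\<dots> = (\<Sum>H'\<in>Pow F'. if H' \<inter> F = H then 2 ^ card F * fourier g F' H' else 0)"
  proof (rule sum.cong[OF refl])
    fix H'
    have "F \<inter> sym_diff H' H = {} \<longleftrightarrow> H' \<inter> F = H" using H by blast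
    then show "fourier g F' H' * (\<Sum>A\<in>Pow F. chi A (sym_diff H' H))
        = (if H' \<inter> F = H then 2 ^ card F * fourier g F' H' else 0)"
      unfolding sum_Pow_chi[OF F] by simp
  qed
  also have "\<dots> = (\<Sum>H' | H' \<in> Pow F' \<and> H' \<inter> F = H. 2 ^ card F * fourier g F' H')"
    using F' by (intro sum.inter_filter[symmetric]) simp
  also have "\<dots> = 2 ^ card F * (\<Sum>H' | H' \<in> Pow F' \<and> H' \<inter> F = H. fourier g F' H')"
    by (simp only: sum_distrib_left)
  finally show ?thesis by (simp add: fourier_def)
qed

text \<open>Poisson summation on the finite group: averaging \<open>chi A H\<close> over the subsets
  \<open>A\<close> of \<open>F - F\<^sub>0\<close> detects whether \<open>H\<close> lies inside
  \<open>F\<^sub>0\<close>.\<close>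

lemma sum_fourier_Pow:
  assumes F: "finite F" and sub: "F\<^sub>0 \<subseteq> F"
  shows "(\<Sum>H\<in>Pow F\<^sub>0. fourier g F H) = (\<Sum>A\<in>Pow (F - F\<^sub>0). g A) / 2 ^ card (F - F\<^sub>0)"
proof -
  let ?D = "F - F\<^sub>0"
  have D: "finite ?D" using F by simp
  have "(\<Sum>A\<in>Pow ?D. g A) = (\<Sum>A\<in>Pow ?D. \<Sum>H\<in>Pow F. fourier g F H * chi A H)"
  proof (rule sum.cong[OF refl])
    fix A assume "A \<in> Pow ?D"
    then have "A \<subseteq> F" by blast
    from fourier_inversion[OF F this, of g]
    show "g A = (\<Sum>H\<in>Pow F. fourier g F H * chi A H)" by (simp only: chi_commute[of A])
  qed
  also have "\<dots> = (\<Sum>H\<in>Pow F. fourier g F H * (\<Sum>A\<in>Pow ?D. chi A H))"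
    by (subst sum.swap) (simp only: sum_distrib_left)
  also have "\<dots> = (\<Sum>H\<in>Pow F. if H \<in> Pow F\<^sub>0 then 2 ^ card ?D * fourier g F H else 0)"
  proof (rule sum.cong[OF refl])
    fix H assume "H \<in> Pow F"
    then have "?D \<inter> H = {} \<longleftrightarrow> H \<in> Pow F\<^sub>0" by blast
    then show "fourier g F H * (\<Sum>A\<in>Pow ?D. chi A H)
        = (if H \<in> Pow F\<^sub>0 then 2 ^ card ?D * fourier g F H else 0)"
      unfolding sum_Pow_chi[OF D] by simp
  qed
  also have "\<dots> = (\<Sum>H | H \<in> Pow F \<and> H \<in> Pow F\<^sub>0. 2 ^ card ?D * fourier g F H)"
    using F by (intro sum.inter_filter[symmetric]) simp
  also have "{H. H \<in> Pow F \<and> H \<in> Pow F\<^sub>0} = Pow F\<^sub>0" using sub by blast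
  finally show ?thesis by (simp flip: sum_distrib_left)
qed

section \<open>Passage to the limit along growing finite edge sets\<close>

context
  fixes K :: "'e set" and g :: "'e set \<Rightarrow> real"
  assumes fourier_nonneg: "\<And>F H. finite F \<Longrightarrow> F \<subseteq> K \<Longrightarrow> H \<subseteq> F \<Longrightarrow> 0 \<le> fourier g F H"
    and g_empty: "g {} = 1"
    and g_cont: "\<And>G \<epsilon>. G \<subseteq> K \<Longrightarrow> \<epsilon> > 0 \<Longrightarrow> \<exists>F. finite F \<and> F \<subseteq> K \<and>
      (\<forall>G'. G' \<subseteq> K \<longrightarrow> G' \<inter> F = G \<inter> F \<longrightarrow> \<bar>g G' - g G\<bar> < \<epsilon>)"
begin

text \<open>\<open>H\<close> is one of the terms in its own marginal sum, and the others are
  nonnegative.\<close>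

lemma fourier_antimono:
  assumes F': "finite F'" "F' \<subseteq> K" and H: "H \<subseteq> F" and sub: "F \<subseteq> F'"
  shows "fourier g F' H \<le> fourier g F H"
  unfolding fourier_restrict[OF F'(1) sub H]
proof (rule member_le_sum)
  show "H \<in> {H' \<in> Pow F'. H' \<inter> F = H}" using H sub by blast
  show "finite {H' \<in> Pow F'. H' \<inter> F = H}" using F' by simp
  show "0 \<le> fourier g F' H'" if "H' \<in> {H' \<in> Pow F'. H' \<inter> F = H} - {H}" for H'
    using that F' by (intro fourier_nonneg) simp_all
qed

text \<open>Since the coefficients decrease as \<open>F\<close> grows, the infimum is their limit;
  \<open>tendsto_fourier\<close> makes this precise.\<close>

definition limit_fourier :: "'e set \<Rightarrow> real" where
  "limit_fourier H = (INF F\<in>{F. finite F \<and> H \<subseteq> F \<and> F \<subseteq> K}. fourier g F H)"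

lemma tendsto_fourier:
  assumes H: "finite H" "H \<subseteq> K"
  shows "((\<lambda>F. fourier g F H) \<longlongrightarrow> limit_fourier H) (finite_subsets_at_top K)"
proof (rule order_tendstoI)
  let ?I = "{F. finite F \<and> H \<subseteq> F \<and> F \<subseteq> K}"
  have bdd: "bdd_below ((\<lambda>F. fourier g F H) ` ?I)"
    by (rule bdd_belowI2[of _ 0]) (simp add: fourier_nonneg)
  have ne: "?I \<noteq> {}" using H by blast
  {
    fix a assume a: "a < limit_fourier H"
    have "\<forall>\<^sub>F F in finite_subsets_at_top K. finite F \<and> H \<subseteq> F \<and> F \<subseteq> K"
      using H by (auto simp: eventually_finite_subsets_at_top)
    then show "\<forall>\<^sub>F F in finite_subsets_at_top K. a < fourier g F H"
    proof (rule eventually_mono)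
      fix F assume "finite F \<and> H \<subseteq> F \<and> F \<subseteq> K"
      then have "limit_fourier H \<le> fourier g F H"
        unfolding limit_fourier_def by (intro cINF_lower[OF bdd]) simp
      with a show "a < fourier g F H" by linarith
    qed
  }
  {
    fix a assume "limit_fourier H < a"
    then obtain F\<^sub>0 where F\<^sub>0: "finite F\<^sub>0" "H \<subseteq> F\<^sub>0" "F\<^sub>0 \<subseteq> K" "fourier g F\<^sub>0 H < a"
      unfolding limit_fourier_def cINF_less_iff[OF ne bdd] by blast
    have "\<forall>\<^sub>F F in finite_subsets_at_top K. finite F \<and> F\<^sub>0 \<subseteq> F \<and> F \<subseteq> K"
      using F\<^sub>0 by (auto simp: eventually_finite_subsets_at_top)
    then show "\<forall>\<^sub>F F in finite_subsets_at_top K. fourier g F H < a"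
    proof (rule eventually_mono)
      fix F assume "finite F \<and> F\<^sub>0 \<subseteq> F \<and> F \<subseteq> K"
      then have "fourier g F H \<le> fourier g F\<^sub>0 H"
        using F\<^sub>0 by (intro fourier_antimono) simp_all
      with F\<^sub>0 show "fourier g F H < a" by linarith
    qed
  }
qed

lemma limit_fourier_nonneg:
  assumes H: "finite H" "H \<subseteq> K"
  shows "0 \<le> limit_fourier H"
  unfolding limit_fourier_def using H by (intro cINF_greatest) (auto simp: fourier_nonneg)

text \<open>Once \<open>F\<close> contains all members of \<open>P\<close>, the sum is part of the
  total mass \<open>g {} = 1\<close>. Only this inequality survives the limit without
  tightness.\<close>

lemma sum_limit_fourier_le_1:
  assumes P: "finite P" "\<And>H. H \<in> P \<Longrightarrow> finite H \<and> H \<subseteq> K"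
  shows "(\<Sum>H\<in>P. limit_fourier H) \<le> 1"
proof (rule tendsto_upperbound)
  show "((\<lambda>F. \<Sum>H\<in>P. fourier g F H) \<longlongrightarrow> (\<Sum>H\<in>P. limit_fourier H)) (finite_subsets_at_top K)"
    using P by (intro tendsto_sum tendsto_fourier) simp_all
  have "finite (\<Union>P)" "\<Union>P \<subseteq> K" using P by auto
  then have "\<forall>\<^sub>F F in finite_subsets_at_top K. finite F \<and> \<Union>P \<subseteq> F \<and> F \<subseteq> K"
    by (auto simp: eventually_finite_subsets_at_top)
  then show "\<forall>\<^sub>F F in finite_subsets_at_top K. (\<Sum>H\<in>P. fourier g F H) \<le> 1"
  proof (rule eventually_mono)
    fix F assume F: "finite F \<and> \<Union>P \<subseteq> F \<and> F \<subseteq> K"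
    then have "P \<subseteq> Pow F" by blast
    then have "(\<Sum>H\<in>P. fourier g F H) \<le> (\<Sum>H\<in>Pow F. fourier g F H)"
      using F by (intro sum_mono2) (simp_all add: fourier_nonneg)
    also have "\<dots> = 1"
      using fourier_inversion[of F "{}" g] F g_empty by simp
    finally show "(\<Sum>H\<in>P. fourier g F H) \<le> 1" .
  qed
qed simp

text \<open>Tightness: by \<open>sum_fourier_Pow\<close> the mass is an average of values of
  \<open>g\<close> at sets avoiding \<open>F\<^sub>0\<close>. The bound is uniform in
  \<open>F\<close>, so it passes to the limit.\<close>

lemma sum_fourier_Pow_ge:
  assumes F: "finite F" "F \<subseteq> K" "F\<^sub>0 \<subseteq> F"
    and close: "\<And>A. A \<subseteq> K \<Longrightarrow> A \<inter> F\<^sub>0 = {} \<Longrightarrow> 1 - \<epsilon> \<le> g A"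
  shows "1 - \<epsilon> \<le> (\<Sum>H\<in>Pow F\<^sub>0. fourier g F H)"
proof -
  have "(\<Sum>A\<in>Pow (F - F\<^sub>0). 1 - \<epsilon>) \<le> (\<Sum>A\<in>Pow (F - F\<^sub>0). g A)"
    using F by (intro sum_mono close) auto
  then have "2 ^ card (F - F\<^sub>0) * (1 - \<epsilon>) \<le> (\<Sum>A\<in>Pow (F - F\<^sub>0). g A)"
    using F by (simp add: card_Pow)
  then show ?thesis
    unfolding sum_fourier_Pow[OF F(1,3)] by (simp add: pos_le_divide_eq mult.commute)
qed

lemma limit_fourier_has_sum:
  assumes G: "G \<subseteq> K"
  shows "((\<lambda>H. chi H G * limit_fourier H) has_sum g G) {H. H \<subseteq> K \<and> finite H}"
  unfolding has_sum_def
proof (rule tendstoI)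
  fix \<epsilon> :: real assume "\<epsilon> > 0"
  \<comment> \<open>Three errors of size at most \<delta> arise: limit mass outside
    \<open>Pow F\<^sub>0\<close>, Fourier mass outside it, and the passage from \<open>G\<close> to
    \<open>G \<inter> F\<^sub>0\<close>. A quarter of \<epsilon> for each leaves room.\<close>
  define \<delta> where "\<delta> = \<epsilon> / 4"
  have "\<delta> > 0" using \<open>\<epsilon> > 0\<close> by (simp add: \<delta>_def)
  obtain F\<^sub>1 where F\<^sub>1: "finite F\<^sub>1" "F\<^sub>1 \<subseteq> K"
    and near_empty: "\<And>A. A \<subseteq> K \<Longrightarrow> A \<inter> F\<^sub>1 = {} \<Longrightarrow> \<bar>g A - 1\<bar> < \<delta>"
    using g_cont[of "{}" \<delta>] \<open>\<delta> > 0\<close> by (auto simp: g_empty)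
  obtain F\<^sub>2 where F\<^sub>2: "finite F\<^sub>2" "F\<^sub>2 \<subseteq> K"
    and near_G: "\<And>A. A \<subseteq> K \<Longrightarrow> A \<inter> F\<^sub>2 = G \<inter> F\<^sub>2 \<Longrightarrow> \<bar>g A - g G\<bar> < \<delta>"
    using g_cont[of G \<delta>] \<open>\<delta> > 0\<close> G by blast
  \<comment> \<open>\<open>F\<^sub>1\<close> supplies tightness, \<open>F\<^sub>2\<close> the
    continuity of \<open>g\<close> at \<open>G\<close>.\<close>
  define F\<^sub>0 where "F\<^sub>0 = F\<^sub>1 \<union> F\<^sub>2"
  have F\<^sub>0: "finite F\<^sub>0" "F\<^sub>0 \<subseteq> K" using F\<^sub>1 F\<^sub>2 by (simp_all add: F\<^sub>0_def)
  have P\<^sub>0: "finite (Pow F\<^sub>0)" "Pow F\<^sub>0 \<subseteq> {H. H \<subseteq> K \<and> finite H}"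
    using F\<^sub>0 by (auto intro: rev_finite_subset)
  have close: "1 - \<delta> \<le> g A" if "A \<subseteq> K" "A \<inter> F\<^sub>0 = {}" for A
  proof -
    have "A \<inter> F\<^sub>1 = {}" using that(2) unfolding F\<^sub>0_def by blast
    with near_empty[OF that(1)] show ?thesis by linarith
  qed
  have ev: "\<forall>\<^sub>F F in finite_subsets_at_top K. finite F \<and> F\<^sub>0 \<subseteq> F \<and> F \<subseteq> K"
    using F\<^sub>0 by (auto simp: eventually_finite_subsets_at_top)
  have lim: "((\<lambda>F. fourier g F H) \<longlongrightarrow> limit_fourier H) (finite_subsets_at_top K)" if "H \<in> Pow F\<^sub>0" for H
    using that P\<^sub>0 by (intro tendsto_fourier) auto
  have mass: "1 - \<delta> \<le> (\<Sum>H\<in>Pow F\<^sub>0. limit_fourier H)"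
  proof (rule tendsto_lowerbound)
    show "((\<lambda>F. \<Sum>H\<in>Pow F\<^sub>0. fourier g F H) \<longlongrightarrow> (\<Sum>H\<in>Pow F\<^sub>0. limit_fourier H)) (finite_subsets_at_top K)"
      by (intro tendsto_sum lim)
    show "\<forall>\<^sub>F F in finite_subsets_at_top K. 1 - \<delta> \<le> (\<Sum>H\<in>Pow F\<^sub>0. fourier g F H)"
      using ev by (rule eventually_mono) (intro sum_fourier_Pow_ge close, simp_all)
  qed simp
  let ?s = "\<lambda>P. \<Sum>H\<in>P. chi H G * limit_fourier H"
  \<comment> \<open>The comparison is made at the finite set \<open>G \<inter> F\<^sub>0\<close>,
    where inversion over \<open>F\<close> applies. On \<open>Pow F\<^sub>0\<close> the signs at
    \<open>G\<close> and at \<open>G \<inter> F\<^sub>0\<close> coincide; the other terms are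
    bounded by their mass.\<close>
  have near: "\<bar>g (G \<inter> F\<^sub>0) - ?s (Pow F\<^sub>0)\<bar> \<le> \<delta>"
  proof (rule tendsto_upperbound)
    show "((\<lambda>F. \<bar>g (G \<inter> F\<^sub>0) - (\<Sum>H\<in>Pow F\<^sub>0. chi H G * fourier g F H)\<bar>)
        \<longlongrightarrow> \<bar>g (G \<inter> F\<^sub>0) - ?s (Pow F\<^sub>0)\<bar>) (finite_subsets_at_top K)"
      by (intro tendsto_intros lim)
    show "\<forall>\<^sub>F F in finite_subsets_at_top K.
        \<bar>g (G \<inter> F\<^sub>0) - (\<Sum>H\<in>Pow F\<^sub>0. chi H G * fourier g F H)\<bar> \<le> \<delta>"
      using ev
    proof (rule eventually_mono)
      fix F assume F: "finite F \<and> F\<^sub>0 \<subseteq> F \<and> F \<subseteq> K"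
      have split: "(\<Sum>H\<in>Pow F. t H) = (\<Sum>H\<in>Pow F - Pow F\<^sub>0. t H) + (\<Sum>H\<in>Pow F\<^sub>0. t H)"
        for t :: "'e set \<Rightarrow> real"
        using F by (intro sum.subset_diff) auto
      have "g (G \<inter> F\<^sub>0) = (\<Sum>H\<in>Pow F. fourier g F H * chi H (G \<inter> F\<^sub>0))"
        using F by (intro fourier_inversion[symmetric]) auto
      also have "\<dots> = (\<Sum>H\<in>Pow F - Pow F\<^sub>0. fourier g F H * chi H (G \<inter> F\<^sub>0))
          + (\<Sum>H\<in>Pow F\<^sub>0. fourier g F H * chi H (G \<inter> F\<^sub>0))" by (rule split)
      also have "(\<Sum>H\<in>Pow F\<^sub>0. fourier g F H * chi H (G \<inter> F\<^sub>0)) = (\<Sum>H\<in>Pow F\<^sub>0. chi H G * fourier g F H)"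
      proof (rule sum.cong[OF refl])
        fix H assume "H \<in> Pow F\<^sub>0"
        then have "H \<inter> (G \<inter> F\<^sub>0) = H \<inter> G" by blast
        then show "fourier g F H * chi H (G \<inter> F\<^sub>0) = chi H G * fourier g F H"
          by (simp add: chi_def)
      qed
      finally have "\<bar>g (G \<inter> F\<^sub>0) - (\<Sum>H\<in>Pow F\<^sub>0. chi H G * fourier g F H)\<bar>
          = \<bar>\<Sum>H\<in>Pow F - Pow F\<^sub>0. fourier g F H * chi H (G \<inter> F\<^sub>0)\<bar>" by simp
      also have "\<dots> \<le> (\<Sum>H\<in>Pow F - Pow F\<^sub>0. fourier g F H)"
        using F by (intro order_trans[OF sum_abs] sum_mono) (simp add: abs_mult fourier_nonneg)
      also have "\<dots> = 1 - (\<Sum>H\<in>Pow F\<^sub>0. fourier g F H)"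
        using split[of "fourier g F"] fourier_inversion[of F "{}" g] F g_empty by simp
      also have "\<dots> \<le> \<delta>"
      proof -
        have "1 - \<delta> \<le> (\<Sum>H\<in>Pow F\<^sub>0. fourier g F H)"
          using F by (intro sum_fourier_Pow_ge close) simp_all
        then show ?thesis by linarith
      qed
      finally show "\<bar>g (G \<inter> F\<^sub>0) - (\<Sum>H\<in>Pow F\<^sub>0. chi H G * fourier g F H)\<bar> \<le> \<delta>" .
    qed
  qed simp
  \<comment> \<open>The total limit mass is at most 1 and \<open>Pow F\<^sub>0\<close> carries at
    least \<open>1 - \<delta>\<close>, so enlarging \<open>Pow F\<^sub>0\<close> to \<open>P\<close>
    changes the sum by at most \<delta>.\<close>
  have "dist (?s P) (g G) < \<epsilon>" if P: "finite P" "Pow F\<^sub>0 \<subseteq> P" "P \<subseteq> {H. H \<subseteq> K \<and> finite H}" for P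
  proof -
    have split: "(\<Sum>H\<in>P. t H) = (\<Sum>H\<in>P - Pow F\<^sub>0. t H) + (\<Sum>H\<in>Pow F\<^sub>0. t H)"
      for t :: "'e set \<Rightarrow> real"
      using P by (intro sum.subset_diff)
    have "\<bar>?s (P - Pow F\<^sub>0)\<bar> \<le> (\<Sum>H\<in>P - Pow F\<^sub>0. limit_fourier H)"
      using P by (intro order_trans[OF sum_abs] sum_mono) (auto simp: abs_mult limit_fourier_nonneg)
    also have "\<dots> \<le> \<delta>"
    proof -
      have "(\<Sum>H\<in>P. limit_fourier H) \<le> 1"
        using P by (intro sum_limit_fourier_le_1) auto
      then show ?thesis using split[of limit_fourier] mass by linarith
    qed
    finally have "\<bar>?s P - ?s (Pow F\<^sub>0)\<bar> \<le> \<delta>"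
      using split[of "\<lambda>H. chi H G * limit_fourier H"] by simp
    moreover have "\<bar>g (G \<inter> F\<^sub>0) - g G\<bar> < \<delta>"
      using G by (intro near_G) (auto simp: F\<^sub>0_def)
    ultimately have "\<bar>?s P - g G\<bar> < 4 * \<delta>" using near \<open>\<delta> > 0\<close> by linarith
    then show ?thesis by (simp add: dist_real_def \<delta>_def)
  qed
  then show "\<forall>\<^sub>F P in finite_subsets_at_top {H. H \<subseteq> K \<and> finite H}. dist (?s P) (g G) < \<epsilon>"
    unfolding eventually_finite_subsets_at_top using P\<^sub>0 by (intro exI[of _ "Pow F\<^sub>0"]) simp
qed

end

section \<open>Bochner's theorem\<close>

text \<open>In the matrix for the two graphs \<open>{}\<close> and \<open>G\<close> both
  off-diagonal entries equal \<open>f G\<close>, so Hermitian symmetry makes that value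
  real.\<close>

lemma positive_definite_real:
  assumes f: "positive_definite V f" and G: "G \<in> graphs V"
  shows "f G = of_real (Re (f G))"
proof -
  let ?G = "\<lambda>i::nat. if i = 0 then {} else G"
  have "positive_semidefinite 2 (\<lambda>i j. f (sym_diff (?G i) (?G j)))"
    using f[unfolded positive_definite_def, rule_format, of 2 ?G] G by simp
  then have "\<forall>i<2. \<forall>j<2. f (sym_diff (?G j) (?G i)) = cnj (f (sym_diff (?G i) (?G j)))"
    unfolding positive_semidefinite_def by (rule conjunct1)
  from this[rule_format, of 0 1] have "f G = cnj (f G)" by simp
  then show ?thesis by (simp add: complex_eq_iff)
qed

text \<open>The matrix indexed by all subsets of \<open>F\<close> is tested on the character vector
  \<open>chi H\<close>; the quadratic form is \<open>4 ^ card F\<close> times the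
  coefficient.\<close>

lemma positive_definite_fourier_nonneg:
  assumes f: "positive_definite V f"
    and F: "finite F" "F \<subseteq> complete_graph V" and H: "H \<subseteq> F"
  shows "0 \<le> fourier (\<lambda>G. Re (f G)) F H"
proof -
  have "finite H" using F(1) H by (rule rev_finite_subset)
  obtain h where h: "bij_betw h {0..<card (Pow F)} (Pow F)"
    using ex_bij_betw_nat_finite[of "Pow F"] F by auto
  define n where "n = card (Pow F)"
  have h: "bij_betw h {..<n} (Pow F)" using h by (simp add: n_def lessThan_atLeast0)
  have "\<forall>i<n. h i \<in> graphs V"
    using bij_betwE[OF h] F by (auto simp: graphs_def)
  then have "positive_semidefinite n (\<lambda>i j. f (sym_diff (h i) (h j)))"
    using f unfolding positive_definite_def by blast
  then have "0 \<le> Re (\<Sum>i<n. \<Sum>j<n. cnj (of_real (chi H (h i))) * f (sym_diff (h i) (h j)) * of_real (chi H (h j)))"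
    unfolding positive_semidefinite_def by (elim conjE allE)
  also have "\<dots> = (\<Sum>i<n. \<Sum>j<n. chi H (h i) * Re (f (sym_diff (h i) (h j))) * chi H (h j))"
    by simp
  also have "\<dots> = (\<Sum>i<n. \<Sum>B\<in>Pow F. chi H (h i) * Re (f (sym_diff (h i) B)) * chi H B)"
    by (intro sum.cong refl sum.reindex_bij_betw[OF h])
  also have "\<dots> = (\<Sum>A\<in>Pow F. \<Sum>B\<in>Pow F. chi H A * Re (f (sym_diff A B)) * chi H B)"
    by (rule sum.reindex_bij_betw[OF h])
  \<comment> \<open>For fixed \<open>A\<close>, substitute the symmetric difference of
    \<open>A\<close> and \<open>B\<close> for \<open>C\<close>; the two signs multiply to
    \<open>chi H C\<close>, so the inner sum no longer depends on \<open>A\<close>.\<close>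
  also have "\<dots> = (\<Sum>A\<in>Pow F. \<Sum>C\<in>Pow F. Re (f C) * chi H C)"
  proof (rule sum.cong[OF refl])
    fix A assume A: "A \<in> Pow F"
    have inv: "sym_diff A (sym_diff A B) = B" for B by blast
    show "(\<Sum>B\<in>Pow F. chi H A * Re (f (sym_diff A B)) * chi H B) = (\<Sum>C\<in>Pow F. Re (f C) * chi H C)"
    proof (rule sum.reindex_bij_witness[where i="sym_diff A" and j="sym_diff A"])
      fix B assume "B \<in> Pow F"
      then show "sym_diff A B \<in> Pow F" "sym_diff A B \<in> Pow F" using A by blast+
      show "Re (f (sym_diff A B)) * chi H (sym_diff A B) = chi H A * Re (f (sym_diff A B)) * chi H B"
        unfolding chi_sym_diff[OF \<open>finite H\<close>] by simp
    qed (rule inv)+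
  qed
  also have "\<dots> = 2 ^ card F * (\<Sum>C\<in>Pow F. Re (f C) * chi H C)"
    using F by (simp add: card_Pow)
  finally show ?thesis by (simp add: fourier_def zero_le_mult_iff power_le_zero_eq)
qed

lemma positive_definite_imp_transform:
  assumes cont: "continuous_map (graph_topology V) euclidean f"
    and f: "positive_definite V f" and one: "f {} = 1"
  obtains \<mu> :: "'a set set \<Rightarrow> real" where "\<And>H. H \<in> finite_graphs V \<Longrightarrow> 0 \<le> \<mu> H"
    "\<And>G. G \<in> graphs V \<Longrightarrow> ((\<lambda>H. chi H G * \<mu> H) has_sum Re (f G)) (finite_graphs V)"
proof -
  let ?g = "\<lambda>G. Re (f G)" and ?K = "complete_graph V"
  have fin: "finite_graphs V = {H. H \<subseteq> ?K \<and> finite H}"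
    by (simp add: finite_graphs_iff set_eq_iff)
  have g_cont: "\<exists>F. finite F \<and> F \<subseteq> ?K \<and>
      (\<forall>G'. G' \<subseteq> ?K \<longrightarrow> G' \<inter> F = G \<inter> F \<longrightarrow> \<bar>?g G' - ?g G\<bar> < \<epsilon>)"
    if "G \<subseteq> ?K" "\<epsilon> > 0" for G \<epsilon>
  proof -
    have "G \<in> graphs V" using that by (simp add: graphs_def)
    with cont \<open>\<epsilon> > 0\<close> obtain F where F: "finite F" "F \<subseteq> ?K"
      "\<And>G'. G' \<in> graphs V \<Longrightarrow> G' \<inter> F = G \<inter> F \<Longrightarrow> dist (f G') (f G) < \<epsilon>"
      unfolding continuous_map_graph_topology by metis
    have "\<bar>?g G' - ?g G\<bar> < \<epsilon>" if "G' \<subseteq> ?K" "G' \<inter> F = G \<inter> F" for G'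
      using F(3)[of G'] that abs_Re_le_cmod[of "f G' - f G"] by (simp add: dist_norm graphs_def)
    with F(1,2) show ?thesis by blast
  qed
  have g_empty: "?g {} = 1" using one by simp
  show ?thesis
  proof
    fix H assume "H \<in> finite_graphs V"
    then have "finite H" "H \<subseteq> ?K" by (simp_all add: finite_graphs_iff)
    with positive_definite_fourier_nonneg[OF f] g_empty g_cont
    show "0 \<le> limit_fourier ?K ?g H" by (rule limit_fourier_nonneg)
  next
    fix G assume "G \<in> graphs V"
    then have "G \<subseteq> ?K" by (simp add: graphs_def)
    with positive_definite_fourier_nonneg[OF f] g_empty g_cont
    show "((\<lambda>H. chi H G * limit_fourier ?K ?g H) has_sum ?g G) (finite_graphs V)"
      unfolding fin by (rule limit_fourier_has_sum)
  qed
qed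

lemma has_sum_sum_finite:
  fixes f :: "'i \<Rightarrow> 'b \<Rightarrow> 'c::topological_comm_monoid_add"
  assumes "finite I" "\<And>i. i \<in> I \<Longrightarrow> (f i has_sum s i) A"
  shows "((\<lambda>x. \<Sum>i\<in>I. f i x) has_sum (\<Sum>i\<in>I. s i)) A"
  using assms by (induction I) (auto intro: has_sum_add has_sum_0)

section \<open>Transforms of probability measures on finite graphs\<close>

context
  fixes V :: "'a set" and \<mu> :: "'a set set \<Rightarrow> real" and f :: "'a set set \<Rightarrow> complex"
  assumes nonneg: "\<And>H. H \<in> finite_graphs V \<Longrightarrow> 0 \<le> \<mu> H"
    and total: "(\<mu> has_sum 1) (finite_graphs V)"
    and transform: "\<And>G. G \<in> graphs V \<Longrightarrow>
      ((\<lambda>H. complex_of_real (chi H G * \<mu> H)) has_sum f G) (finite_graphs V)"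
begin

lemma transform_Re:
  assumes "G \<in> graphs V"
  shows "((\<lambda>H. chi H G * \<mu> H) has_sum Re (f G)) (finite_graphs V)"
  using has_sum_Re[OF transform[OF assms]] by simp

lemma transform_real:
  assumes "G \<in> graphs V"
  shows "f G = of_real (Re (f G))"
  using has_sum_of_real[OF transform_Re[OF assms], where 'a=complex] transform[OF assms]
  by (rule has_sum_unique[symmetric])

lemma transform_empty: "f {} = 1"
proof -
  have "Re (f {}) = 1"
    using transform_Re[of "{}"] total by (simp add: has_sum_unique)
  then show ?thesis using transform_real[of "{}"] by simp
qed

text \<open>A finite set \<open>P\<close> of finite graphs carries almost all the mass. Graphs that
  agree on the edges occurring in \<open>P\<close> give equal terms for members of \<open>P\<close>,
  and every other term changes by at most \<open>2 * \<mu> H\<close>.\<close>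

lemma transform_continuous: "continuous_map (graph_topology V) euclidean f"
  unfolding continuous_map_graph_topology
proof (intro ballI allI impI)
  fix G and \<epsilon> :: real assume G: "G \<in> graphs V" and "\<epsilon> > 0"
  \<comment> \<open>Half of \<epsilon>, because two signs can differ by 2.\<close>
  have "\<forall>\<^sub>F P in finite_subsets_at_top (finite_graphs V). 1 - \<epsilon> / 2 < sum \<mu> P"
    using total \<open>\<epsilon> > 0\<close> unfolding has_sum_def by (elim order_tendstoD(1)) (simp add: field_simps)
  then obtain P where P: "finite P" "P \<subseteq> finite_graphs V" "1 - \<epsilon> / 2 < sum \<mu> P"
    unfolding eventually_finite_subsets_at_top by blast
  have close: "dist (f G') (f G) < \<epsilon>" if G': "G' \<in> graphs V" "G' \<inter> \<Union>P = G \<inter> \<Union>P" for G'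
  proof -
    have eq: "chi H G' = chi H G" if "H \<in> P" for H
    proof -
      have "H \<inter> G' = H \<inter> G" using that G'(2) by blast
      then show ?thesis by (simp add: chi_def)
    qed
    have diff: "((\<lambda>H. (chi H A - chi H B) * \<mu> H) has_sum (Re (f A) - Re (f B))) (finite_graphs V)"
      if "A \<in> graphs V" "B \<in> graphs V" for A B
      using has_sum_add[OF transform_Re[OF that(1)] has_sum_cmult_right[OF transform_Re[OF that(2)], of "-1"]]
      by (simp add: left_diff_distrib)
    have "((\<lambda>H. 2 * \<mu> H) has_sum 2 * (1 - sum \<mu> P)) (finite_graphs V - P)"
      using has_sum_Diff[OF total has_sum_finite[OF P(1)] P(2)] by (rule has_sum_cmult_right)
    then have bound: "((\<lambda>H. if H \<in> P then 0 else 2 * \<mu> H) has_sum 2 * (1 - sum \<mu> P)) (finite_graphs V)"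
      by (rule has_sum_cong_neutral[THEN iffD1, rotated -1]) auto
    have le: "\<bar>(chi H G' - chi H G) * \<mu> H\<bar> \<le> (if H \<in> P then 0 else 2 * \<mu> H)" if "H \<in> finite_graphs V" for H
    proof (cases "H \<in> P")
      case False
      have "\<bar>chi H G' - chi H G\<bar> \<le> 2"
        using abs_triangle_ineq4[of "chi H G'" "chi H G"] by simp
      with False nonneg[OF that] show ?thesis by (simp add: abs_mult mult_right_mono)
    qed (simp add: eq)
    have "Re (f G') - Re (f G) \<le> 2 * (1 - sum \<mu> P)"
      using diff[OF G'(1) G] bound by (rule has_sum_mono) (use le in \<open>auto simp: abs_le_iff\<close>)
    moreover have "Re (f G) - Re (f G') \<le> 2 * (1 - sum \<mu> P)"
      using diff[OF G G'(1)] bound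
      by (rule has_sum_mono) (use le in \<open>auto simp: abs_le_iff left_diff_distrib\<close>)
    moreover have "2 * (1 - sum \<mu> P) < \<epsilon>" using P(3) by (simp add: field_simps)
    ultimately have "\<bar>Re (f G') - Re (f G)\<bar> < \<epsilon>" unfolding abs_less_iff by linarith
    then show ?thesis
      by (subst (1 2) transform_real) (simp_all add: G G' dist_of_real dist_real_def)
  qed
  have "finite (\<Union>P)" "\<Union>P \<subseteq> complete_graph V"
    using P(1,2) by (auto simp: finite_graphs_iff subset_iff)
  then show "\<exists>F. finite F \<and> F \<subseteq> complete_graph V \<and>
      (\<forall>G'\<in>graphs V. G' \<inter> F = G \<inter> F \<longrightarrow> dist (f G') (f G) < \<epsilon>)"
    by (intro exI[of _ "\<Union>P"] conjI ballI impI close)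
qed

text \<open>Each \<open>H\<close> contributes \<open>\<mu> H\<close> times the squared modulus of
  \<open>?w H\<close>, since \<open>chi H\<close> is multiplicative; the quadratic form is a sum of
  these nonnegative terms.\<close>

lemma transform_positive_definite: "positive_definite V f"
  unfolding positive_definite_def
proof (intro allI impI)
  fix n and G :: "nat \<Rightarrow> 'a set set" assume "\<forall>i<n. G i \<in> graphs V"
  then have G: "G i \<in> graphs V" if "i < n" for i using that by blast
  show "positive_semidefinite n (\<lambda>i j. f (sym_diff (G i) (G j)))"
    unfolding positive_semidefinite_def
  proof (intro conjI allI impI)
    fix i j assume ij: "i < n" "j < n"
    have "sym_diff (G j) (G i) = sym_diff (G i) (G j)" by blast
    then show "f (sym_diff (G j) (G i)) = cnj (f (sym_diff (G i) (G j)))"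
      using transform_real[OF sym_diff_graphs[OF G[OF ij(1)] G[OF ij(2)]]]
      by (metis complex_cnj_complex_of_real)
  next
    fix z :: "nat \<Rightarrow> complex"
    let ?w = "\<lambda>H. \<Sum>i<n. of_real (chi H (G i)) * z i"
    have "((\<lambda>H. \<Sum>i<n. \<Sum>j<n. cnj (z i) * of_real (chi H (sym_diff (G i) (G j)) * \<mu> H) * z j)
        has_sum (\<Sum>i<n. \<Sum>j<n. cnj (z i) * f (sym_diff (G i) (G j)) * z j)) (finite_graphs V)"
      by (intro has_sum_sum_finite has_sum_cmult_left has_sum_cmult_right transform sym_diff_graphs)
         (simp_all add: G)
    then have "((\<lambda>H. Re (\<Sum>i<n. \<Sum>j<n. cnj (z i) * of_real (chi H (sym_diff (G i) (G j)) * \<mu> H) * z j))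
        has_sum Re (\<Sum>i<n. \<Sum>j<n. cnj (z i) * f (sym_diff (G i) (G j)) * z j)) (finite_graphs V)"
      by (rule has_sum_Re)
    then show "0 \<le> Re (\<Sum>i<n. \<Sum>j<n. cnj (z i) * f (sym_diff (G i) (G j)) * z j)"
    proof (rule has_sum_nonneg)
      fix H assume H: "H \<in> finite_graphs V"
      then have fin: "finite H" by (simp add: finite_graphs_iff)
      have "(\<Sum>i<n. \<Sum>j<n. cnj (z i) * of_real (chi H (sym_diff (G i) (G j)) * \<mu> H) * z j)
          = of_real (\<mu> H) * (cnj (?w H) * ?w H)"
        unfolding chi_sym_diff[OF fin] cnj_sum sum_product unfolding sum_distrib_left
        by (intro sum.cong refl) simp
      also have "cnj (?w H) * ?w H = of_real ((cmod (?w H))\<^sup>2)"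
        by (simp only: complex_norm_square mult.commute)
      finally show "0 \<le> Re (\<Sum>i<n. \<Sum>j<n. cnj (z i) * of_real (chi H (sym_diff (G i) (G j)) * \<mu> H) * z j)"
        using nonneg[OF H] by simp
    qed
  qed
qed

end

theorem theorem3p5:
  fixes V :: "'a set"
  assumes "countable V"
  shows "subgroup (finite_graphs V) (graph_group V) \<and>
    walsh V \<in> iso (graph_group V\<lparr>carrier := finite_graphs V\<rparr>)
                  (pontryagin_dual (graph_group V) (graph_topology V)) \<and>
    L2_orthonormal_basis (haar_prob V) (finite_graphs V) (\<lambda>E G. Re (walsh V E G)) \<and>
    (\<forall>f :: 'a set set \<Rightarrow> complex.
       (continuous_map (graph_topology V) euclidean f \<and> positive_definite V f \<and> f {} = 1) \<longleftrightarrow>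
       (\<exists>\<mu> :: 'a set set \<Rightarrow> real.
          (\<forall>H\<in>finite_graphs V. 0 \<le> \<mu> H) \<and>
          (\<mu> has_sum 1) (finite_graphs V) \<and>
          (\<forall>G\<in>graphs V.
             ((\<lambda>H. (- 1) ^ card (G \<inter> H) * complex_of_real (\<mu> H)) has_sum f G) (finite_graphs V))))"
proof (intro conjI allI iffI)
  show "subgroup (finite_graphs V) (graph_group V)" by (rule subgroup_finite_graphs)
  show "walsh V \<in> iso (graph_group V\<lparr>carrier := finite_graphs V\<rparr>)
                  (pontryagin_dual (graph_group V) (graph_topology V))" by (rule walsh_iso)
  show "L2_orthonormal_basis (haar_prob V) (finite_graphs V) (\<lambda>E G. Re (walsh V E G))"
    using assms is_haar_prob_haar_prob[OF assms] by (rule haar_walsh_orthonormal_basis)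
next
  have coefficient: "(- 1) ^ card (G \<inter> H) * complex_of_real m = of_real (chi H G * m)" for G H :: "'a set set" and m
    by (simp add: chi_def Int_commute)
  fix f :: "'a set set \<Rightarrow> complex"
  {
    assume "continuous_map (graph_topology V) euclidean f \<and> positive_definite V f \<and> f {} = 1"
    then have f: "continuous_map (graph_topology V) euclidean f" "positive_definite V f" "f {} = 1"
      by blast+
    obtain \<mu> where \<mu>: "\<And>H. H \<in> finite_graphs V \<Longrightarrow> 0 \<le> \<mu> H"
      "\<And>G. G \<in> graphs V \<Longrightarrow> ((\<lambda>H. chi H G * \<mu> H) has_sum Re (f G)) (finite_graphs V)"
      using positive_definite_imp_transform[OF f] by metis
    \<comment> \<open>At the empty graph all signs are 1, so the transform gives the total
      mass.\<close>
    have "(\<mu> has_sum 1) (finite_graphs V)"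
      using \<mu>(2)[of "{}"] f(3) by simp
    moreover have "((\<lambda>H. (- 1) ^ card (G \<inter> H) * complex_of_real (\<mu> H)) has_sum f G) (finite_graphs V)"
      if "G \<in> graphs V" for G
      unfolding coefficient using has_sum_of_real[OF \<mu>(2)[OF that], where 'a=complex]
      by (simp only: positive_definite_real[OF f(2) that, symmetric])
    ultimately show "\<exists>\<mu> :: 'a set set \<Rightarrow> real.
        (\<forall>H\<in>finite_graphs V. 0 \<le> \<mu> H) \<and> (\<mu> has_sum 1) (finite_graphs V) \<and>
        (\<forall>G\<in>graphs V.
          ((\<lambda>H. (- 1) ^ card (G \<inter> H) * complex_of_real (\<mu> H)) has_sum f G) (finite_graphs V))"
      using \<mu>(1) by blast
  }
  assume "\<exists>\<mu> :: 'a set set \<Rightarrow> real.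
      (\<forall>H\<in>finite_graphs V. 0 \<le> \<mu> H) \<and> (\<mu> has_sum 1) (finite_graphs V) \<and>
      (\<forall>G\<in>graphs V.
        ((\<lambda>H. (- 1) ^ card (G \<inter> H) * complex_of_real (\<mu> H)) has_sum f G) (finite_graphs V))"
  then obtain \<mu> :: "'a set set \<Rightarrow> real" where \<mu>: "\<And>H. H \<in> finite_graphs V \<Longrightarrow> 0 \<le> \<mu> H"
    "(\<mu> has_sum 1) (finite_graphs V)"
    "\<And>G. G \<in> graphs V \<Longrightarrow> ((\<lambda>H. complex_of_real (chi H G * \<mu> H)) has_sum f G) (finite_graphs V)"
    unfolding coefficient by blast
  show "continuous_map (graph_topology V) euclidean f" using \<mu> by (rule transform_continuous)
  show "positive_definite V f" using \<mu> by (rule transform_positive_definite)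
  show "f {} = 1" using \<mu> by (rule transform_empty)
qed

end
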